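(* Let $\mathcal H$ be a real Hilbert space with a complex structure $J$, and let $\epsilon_0,\epsilon_1\in\Lambda_J(\mathcal H)$. Then there exists a minimal geodesic of $\Lambda_J(\mathcal H)$ joining $\epsilon_0$ and $\epsilon_1$, i.e. a geodesic $\delta:[0,1]\to\Lambda_J(\mathcal H)$ with $\delta(0)=\epsilon_0$, $\delta(1)=\epsilon_1$ whose length is less than or equal to the length of every curve in $\Lambda_J(\mathcal H)$ joining $\epsilon_0$ and $\epsilon_1$. The minimal geodesic is unique if $\|\epsilon_0-\epsilon_1\|<2$.
   Context: $\mathcal H$ is a real Hilbert space (finite or infinite dimensional); $J$ is a bounded operator on $\mathcal H$ with $J^*=-J$ and $J^2=-I$ (here $*$ is the transpose). A closed subspace $L$ is Lagrangian if $J(L)=L^\perp$; identifying a closed subspace $S$ with the symmetry $\epsilon_S=2p_S-I$ ($p_S$ the orthogonal projection onto $S$), the Lagrangian Grassmannian is $\Lambda_J(\mathcal H)=\{\epsilon\in\mathcal B(\mathcal H):\epsilon^*=\epsilon=\epsilon^{-1},\ \epsilon J=-J\epsilon\}$. The linear connection on $\Lambda_J(\mathcal H)$ is given by the covariant derivative $\frac{D}{dt}X=\Pi_{\gamma(t)}(\dot X(t))$ of a tangent field $X$ along a curve $\gamma$, where $\Pi_\epsilon(a)=\frac12(a-\epsilon a\epsilon)$; its geodesics starting at $\epsilon_0$ are the curves $\delta(t)=e^{tz}\epsilon_0e^{-tz}=e^{2tz}\epsilon_0$ with $z\in\mathcal B(\mathcal H)$, $z^*=-z$, $z\epsilon_0=-\epsilon_0z$,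 $zJ=Jz$. The length of a (piecewise $C^1$) curve $\gamma:[t_0,t_1]\to\Lambda_J(\mathcal H)$ is $L(\gamma)=\int_{t_0}^{t_1}\|\dot\gamma(t)\|\,dt$, with $\|\cdot\|$ the operator norm. *)

theory Defs
  imports "HOL-Analysis.Analysis"
begin

text \<open>
  A real Hilbert space is a type of sort \<open>{real_inner, banach}\<close>; no dimension is fixed.
  Bounded operators form the type \<open>'a \<Rightarrow>\<^sub>L 'a\<close>, whose norm is the operator norm.
\<close>

text \<open>
  \<open>is_adjoint A B\<close> says that \<open>B\<close> is the transpose of \<open>A\<close>. It is given as a relation because
  the function \<open>adjoint\<close> of the library is developed for finite dimension only;
  \<open>is_adjoint_unique\<close> shows that it determines \<open>B\<close>.
\<close>

definition is_adjoint :: "('a::real_inner \<Rightarrow>\<^sub>L 'a) \<Rightarrow> ('a \<Rightarrow>\<^sub>L 'a) \<Rightarrow> bool" where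
  "is_adjoint A B \<longleftrightarrow> (\<forall>x y. inner (blinfun_apply A x) y = inner x (blinfun_apply B y))"

lemma is_adjoint_unique:
  assumes "is_adjoint A B" "is_adjoint A C"
  shows "B = C"
proof (rule blinfun_eqI)
  fix y
  have "\<forall>x. inner x (blinfun_apply B y) = inner x (blinfun_apply C y)"
    using assms unfolding is_adjoint_def by metis
  then show "blinfun_apply B y = blinfun_apply C y"
    by (simp add: vector_eq_ldot)
qed

definition complex_structure :: "('a::real_inner \<Rightarrow>\<^sub>L 'a) \<Rightarrow> bool" where
  "complex_structure J \<longleftrightarrow> is_adjoint J (- J) \<and> J o\<^sub>L J = - id_blinfun"

text \<open>A Lagrangian subspace \<open>S\<close> is represented by the symmetry \<open>2 p\<^sub>S - I\<close>.\<close>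

definition lagrangian_grassmannian :: "('a::real_inner \<Rightarrow>\<^sub>L 'a) \<Rightarrow> ('a \<Rightarrow>\<^sub>L 'a) set" where
  "lagrangian_grassmannian J =
     {\<epsilon>. is_adjoint \<epsilon> \<epsilon> \<and> \<epsilon> o\<^sub>L \<epsilon> = id_blinfun \<and> \<epsilon> o\<^sub>L J = - (J o\<^sub>L \<epsilon>)}"

text \<open>
  A curve on \<open>[a, b]\<close> is a total function of which only the restriction to \<open>{a..b}\<close> matters;
  accordingly derivatives are taken within \<open>{a..b}\<close>, hence are one-sided at \<open>a\<close> and \<open>b\<close>.
\<close>

definition velocity :: "real \<Rightarrow> real \<Rightarrow> (real \<Rightarrow> 'b::real_normed_vector) \<Rightarrow> real \<Rightarrow> 'b" where
  "velocity a b \<gamma> t = vector_derivative \<gamma> (at t within {a..b})"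

definition C1_on :: "real \<Rightarrow> real \<Rightarrow> (real \<Rightarrow> 'b::real_normed_vector) \<Rightarrow> bool" where
  "C1_on a b \<gamma> \<longleftrightarrow> \<gamma> differentiable_on {a..b} \<and> continuous_on {a..b} (velocity a b \<gamma>)"

text \<open>
  The library's \<open>piecewise_C1_differentiable_on\<close> lets the derivative blow up at the break points,
  and then the length integral below may fail to exist (and silently be 0). Here, as usual,
  the curve is continuously differentiable on each closed piece of a subdivision.
\<close>

definition piecewise_C1_on :: "real \<Rightarrow> real \<Rightarrow> (real \<Rightarrow> 'b::real_normed_vector) \<Rightarrow> bool" where
  "piecewise_C1_on a b \<gamma> \<longleftrightarrow>
     (\<exists>(n::nat) s. s 0 = a \<and> s n = b \<and>
        (\<forall>i<n. s i < s (Suc i) \<and> C1_on (s i) (s (Suc i)) \<gamma>))"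

text \<open>At the finitely many break points the value of the integrand is irrelevant.\<close>

definition curve_length :: "real \<Rightarrow> real \<Rightarrow> (real \<Rightarrow> 'b::real_normed_vector) \<Rightarrow> real" where
  "curve_length a b \<gamma> = integral {a..b} (\<lambda>t. norm (velocity a b \<gamma> t))"

definition joins :: "real \<Rightarrow> real \<Rightarrow> (real \<Rightarrow> 'b) \<Rightarrow> 'b \<Rightarrow> 'b \<Rightarrow> bool" where
  "joins a b \<gamma> p q \<longleftrightarrow> \<gamma> a = p \<and> \<gamma> b = q"

definition tangent_proj ::
  "('a::real_normed_vector \<Rightarrow>\<^sub>L 'a) \<Rightarrow> ('a \<Rightarrow>\<^sub>L 'a) \<Rightarrow> ('a \<Rightarrow>\<^sub>L 'a)" where
  "tangent_proj \<epsilon> x = (1/2) *\<^sub>R (x - (\<epsilon> o\<^sub>L x o\<^sub>L \<epsilon>))"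

definition covariant_derivative ::
  "real \<Rightarrow> real \<Rightarrow> (real \<Rightarrow> ('a::real_normed_vector \<Rightarrow>\<^sub>L 'a)) \<Rightarrow>
     (real \<Rightarrow> ('a \<Rightarrow>\<^sub>L 'a)) \<Rightarrow> real \<Rightarrow> ('a \<Rightarrow>\<^sub>L 'a)" where
  "covariant_derivative a b \<gamma> X t = tangent_proj (\<gamma> t) (velocity a b X t)"

text \<open>
  Geodesics are the curves whose velocity field is parallel. Differentiating \<open>\<gamma>\<^sup>2 = I\<close> twice turns
  the equation into \<open>\<gamma>'' = - \<gamma>'\<^sup>2 \<gamma>\<close>, so \<open>z = \<gamma>' \<gamma> / 2\<close> is constant and
  \<open>\<gamma> t = e\<^bsup>2tz\<^esup> \<gamma> 0\<close>; thus asking for two derivatives gives smooth curves.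
\<close>

definition geodesic ::
  "('a::real_inner \<Rightarrow>\<^sub>L 'a) \<Rightarrow> real \<Rightarrow> real \<Rightarrow> (real \<Rightarrow> ('a \<Rightarrow>\<^sub>L 'a)) \<Rightarrow> bool" where
  "geodesic J a b \<gamma> \<longleftrightarrow>
     (\<forall>t\<in>{a..b}. \<gamma> t \<in> lagrangian_grassmannian J) \<and>
     \<gamma> differentiable_on {a..b} \<and>
     velocity a b \<gamma> differentiable_on {a..b} \<and>
     (\<forall>t\<in>{a..b}. covariant_derivative a b \<gamma> (velocity a b \<gamma>) t = 0)"

definition minimal_geodesic ::
  "('a::real_inner \<Rightarrow>\<^sub>L 'a) \<Rightarrow> ('a \<Rightarrow>\<^sub>L 'a) \<Rightarrow> ('a \<Rightarrow>\<^sub>L 'a) \<Rightarrow>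
     (real \<Rightarrow> ('a \<Rightarrow>\<^sub>L 'a)) \<Rightarrow> bool" where
  "minimal_geodesic J \<epsilon>\<^sub>0 \<epsilon>\<^sub>1 \<delta> \<longleftrightarrow>
     geodesic J 0 1 \<delta> \<and> joins 0 1 \<delta> \<epsilon>\<^sub>0 \<epsilon>\<^sub>1 \<and>
     (\<forall>a b \<gamma>. a < b \<and> piecewise_C1_on a b \<gamma> \<and>
        (\<forall>t\<in>{a..b}. \<gamma> t \<in> lagrangian_grassmannian J) \<and> joins a b \<gamma> \<epsilon>\<^sub>0 \<epsilon>\<^sub>1
        \<longrightarrow> curve_length 0 1 \<delta> \<le> curve_length a b \<gamma>)"

end

theory Submission imports Defs begin

text \<open>
  Read \<open>J\<close> as the imaginary unit. Then \<open>u = \<epsilon>\<^sub>1 \<epsilon>\<^sub>0\<close> is unitary, \<open>u = C + J S\<close> with commuting symmetric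
  \<open>C\<close>, \<open>S\<close>, and a geodesic from \<open>\<epsilon>\<^sub>0\<close> to \<open>\<epsilon>\<^sub>1\<close> is \<open>e\<^bsup>tw\<^esup> \<epsilon>\<^sub>0\<close> for a skew logarithm \<open>w\<close> of \<open>u\<close> that
  commutes with \<open>J\<close> and anticommutes with \<open>\<epsilon>\<^sub>0\<close>. One takes \<open>w = Q J arccos C\<close>, where the symmetry \<open>Q\<close> is
  a sign of \<open>S\<close>, equal to \<open>I\<close> where \<open>u = -I\<close>. With \<open>\<kappa> = \<parallel>I - C\<parallel>\<close> this gives \<open>\<parallel>w\<parallel> \<le> arccos (1 - \<kappa>)\<close>.

  For a unit vector \<open>x\<close> and a curve \<open>\<gamma>\<close> from \<open>\<epsilon>\<^sub>0\<close> to \<open>\<epsilon>\<^sub>1\<close>, the curve \<open>\<gamma> x\<close> runs in the unit sphere and is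
  no longer than \<open>\<gamma>\<close>. Its end points enclose the angle \<open>arccos \<langle>C x, x\<rangle>\<close>, and the supremum over \<open>x\<close> is
  \<open>arccos (1 - \<kappa>)\<close>. So the geodesic above is minimal.

  If \<open>\<parallel>\<epsilon>\<^sub>0 - \<epsilon>\<^sub>1\<parallel> < 2\<close> then \<open>\<kappa> < 2\<close>, hence any minimal geodesic has a logarithm \<open>w'\<close> with
  \<open>\<parallel>w'\<parallel> \<le> arccos (1 - \<kappa>) < \<pi>\<close>. It commutes with \<open>u\<close>, so with \<open>e\<^bsup>tw\<^esup>\<close>, and \<open>w' - w\<close> generates a
  flow of period \<open>1\<close> with \<open>\<parallel>w' - w\<parallel> < 2 \<pi>\<close>. A Wirtinger inequality forces \<open>w' = w\<close>.
\<close>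

section \<open>Symmetric operators\<close>

abbreviation commuting :: "('a::real_normed_vector \<Rightarrow>\<^sub>L 'a) \<Rightarrow> ('a \<Rightarrow>\<^sub>L 'a) \<Rightarrow> bool" where
  "commuting X Y \<equiv> X o\<^sub>L Y = Y o\<^sub>L X"

lemma commutingD: "commuting X Y \<Longrightarrow> blinfun_apply X (blinfun_apply Y x) = blinfun_apply Y (blinfun_apply X x)"
  by (metis blinfun_apply_blinfun_compose)

lemma commutingI: "(\<And>x. blinfun_apply X (blinfun_apply Y x) = blinfun_apply Y (blinfun_apply X x)) \<Longrightarrow> commuting X Y"
  by (rule blinfun_eqI) simp

lemma blinfun_compose_eqD: "X o\<^sub>L Y = Z \<Longrightarrow> blinfun_apply X (blinfun_apply Y x) = blinfun_apply Z x"
  by (metis blinfun_apply_blinfun_compose)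

lemma is_adjointD: "is_adjoint A B \<Longrightarrow> inner (blinfun_apply A x) y = inner x (blinfun_apply B y)"
  by (simp add: is_adjoint_def)

lemma is_adjoint_compose:
  "is_adjoint A A' \<Longrightarrow> is_adjoint B B' \<Longrightarrow> is_adjoint (A o\<^sub>L B) (B' o\<^sub>L A')"
  by (simp add: is_adjoint_def)

lemma is_adjoint_add: "is_adjoint A A' \<Longrightarrow> is_adjoint B B' \<Longrightarrow> is_adjoint (A + B) (A' + B')"
  by (simp add: is_adjoint_def blinfun.bilinear_simps inner_simps)

lemma is_adjoint_diff: "is_adjoint A A' \<Longrightarrow> is_adjoint B B' \<Longrightarrow> is_adjoint (A - B) (A' - B')"
  by (simp add: is_adjoint_def blinfun.bilinear_simps inner_simps)

lemma is_adjoint_minus: "is_adjoint A A' \<Longrightarrow> is_adjoint (- A) (- A')"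
  by (simp add: is_adjoint_def blinfun.bilinear_simps)

lemma is_adjoint_scaleR: "is_adjoint A A' \<Longrightarrow> is_adjoint (r *\<^sub>R A) (r *\<^sub>R A')"
  by (simp add: is_adjoint_def blinfun.bilinear_simps)

lemma is_adjoint_id: "is_adjoint id_blinfun id_blinfun"
  by (simp add: is_adjoint_def)

lemmas is_adjoint_intros = is_adjoint_compose is_adjoint_add is_adjoint_diff is_adjoint_minus
  is_adjoint_scaleR is_adjoint_id

lemma is_adjoint_LIMSEQ:
  assumes "\<And>n. is_adjoint (X n) (X n)" "X \<longlonglongrightarrow> L"
  shows "is_adjoint L L"
  unfolding is_adjoint_def
proof (intro allI)
  fix x y
  have "(\<lambda>n. inner (X n x) y) \<longlonglongrightarrow> inner (L x) y" "(\<lambda>n. inner x (X n y)) \<longlonglongrightarrow> inner x (L y)"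
    by (intro tendsto_intros assms)+
  moreover have "(\<lambda>n. inner (X n x) y) = (\<lambda>n. inner x (X n y))"
    using assms(1) by (simp add: is_adjoint_def)
  ultimately show "inner (L x) y = inner x (L y)"
    using LIMSEQ_unique by metis
qed

lemma commuting_LIMSEQ:
  assumes "\<And>n. commuting Z (X n)" "X \<longlonglongrightarrow> L"
  shows "commuting Z L"
proof (rule commutingI)
  fix x
  have "(\<lambda>n. Z (X n x)) \<longlonglongrightarrow> Z (L x)" "(\<lambda>n. X n (Z x)) \<longlonglongrightarrow> L (Z x)"
    by (intro tendsto_intros assms)+
  moreover have "(\<lambda>n. Z (X n x)) = (\<lambda>n. X n (Z x))"
    using assms(1) by (simp add: commutingD)
  ultimately show "Z (L x) = L (Z x)"
    using LIMSEQ_unique by metis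
qed

lemmas has_vector_derivative_compose =
  bounded_bilinear.has_vector_derivative[OF bounded_bilinear_blinfun_compose]

lemma blinfun_compose_assoc: "(X o\<^sub>L Y) o\<^sub>L Z = X o\<^sub>L (Y o\<^sub>L Z)"
  by (rule blinfun_eqI) simp

lemma norm_isometry:
  fixes X :: "'a::real_inner \<Rightarrow>\<^sub>L 'a"
  assumes "is_adjoint X X'" "X' o\<^sub>L X = id_blinfun"
  shows "norm (X x) = norm x"
proof -
  have "inner (X x) (X x) = inner x x"
    using assms(1) blinfun_compose_eqD[OF assms(2), of x] by (simp add: is_adjoint_def)
  then show ?thesis by (simp add: norm_eq_sqrt_inner)
qed

lemma symmetric_square_inner:
  "is_adjoint N N \<Longrightarrow> inner (blinfun_apply N (blinfun_apply N x)) y =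
    inner (blinfun_apply N x) (blinfun_apply N y)"
  by (simp add: is_adjoint_def)

text \<open>Polarization writes \<open>4 * inner (X x) y\<close> as a difference of two values of
  the quadratic form, and the parallelogram law bounds that difference.\<close>

lemma symmetric_norm_le:
  fixes X :: "'a::real_inner \<Rightarrow>\<^sub>L 'a"
  assumes "is_adjoint X X" "0 \<le> K" "\<And>x. \<bar>inner (X x) x\<bar> \<le> K * (norm x)\<^sup>2"
  shows "norm X \<le> K"
proof (rule norm_blinfun_bound[OF \<open>0 \<le> K\<close>])
  fix x
  show "norm (X x) \<le> K * norm x"
  proof (cases "X x = 0")
    case True
    then show ?thesis using \<open>0 \<le> K\<close> by simp
  next
    case False
    then have "x \<noteq> 0" by (auto simp: blinfun.zero_right)
    \<comment> \<open>Parallel to \<open>X x\<close>, so that the inner product attains the norm,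
      and of the same length as \<open>x\<close>, so that the parallelogram bound becomes
      \<open>4 * K * (norm x)\<^sup>2\<close>.\<close>
    define y where "y = (norm x / norm (X x)) *\<^sub>R X x"
    have ny: "norm y = norm x" using False by (simp add: y_def)
    have "4 * inner (X x) y = inner (X (x + y)) (x + y) - inner (X (x - y)) (x - y)"
      using assms(1) by (simp add: is_adjoint_def blinfun.bilinear_simps inner_simps inner_commute)
    also have "\<dots> \<le> K * (norm (x + y))\<^sup>2 + K * (norm (x - y))\<^sup>2"
      using assms(3)[of "x + y"] assms(3)[of "x - y"] by linarith
    also have "\<dots> = K * (2 * (norm x)\<^sup>2 + 2 * (norm y)\<^sup>2)"
      by (simp add: power2_norm_eq_inner inner_simps algebra_simps inner_commute)
    finally have "inner (X x) y \<le> K * (norm x)\<^sup>2"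
      by (simp add: ny)
    moreover have "inner (X x) y = norm x * norm (X x)"
      using False by (simp add: y_def power2_norm_eq_inner[symmetric] power2_eq_square)
    ultimately have "norm x * norm (X x) \<le> norm x * (K * norm x)"
      by (simp add: power2_eq_square mult_ac)
    then show ?thesis using \<open>x \<noteq> 0\<close> by simp
  qed
qed

section \<open>Continuous functional calculus\<close>

lemma scaleR_mult_2: "(r * 2) *\<^sub>R z = r *\<^sub>R z + r *\<^sub>R (z :: 'a::real_vector)"
  by (simp flip: scaleR_add_left)

text \<open>
  \<open>bern T n G\<close> is the expectation of \<open>G k\<close> for \<open>k\<close> binomially distributed with \<open>n\<close> trials, with \<open>T\<close> as
  the probability of success: the Bernstein operator with \<open>T\<close> in place of the real variable.
\<close>

primrec bern :: "('a::real_normed_vector \<Rightarrow>\<^sub>L 'a) \<Rightarrow> nat \<Rightarrow> (nat \<Rightarrow> ('a \<Rightarrow>\<^sub>L 'a)) \<Rightarrow> ('a \<Rightarrow>\<^sub>L 'a)" where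
  "bern T 0 G = G 0"
| "bern T (Suc n) G = ((id_blinfun - T) o\<^sub>L bern T n G) + (T o\<^sub>L bern T n (\<lambda>k. G (Suc k)))"

lemma bern_add: "bern T n (\<lambda>k. G k + H k) = bern T n G + bern T n H"
  by (induction n arbitrary: G H)
    (auto intro!: blinfun_eqI simp: blinfun.bilinear_simps algebra_simps)

lemma bern_scaleR: "bern T n (\<lambda>k. r *\<^sub>R G k) = r *\<^sub>R bern T n G"
  by (induction n arbitrary: G)
    (auto intro!: blinfun_eqI simp: blinfun.bilinear_simps algebra_simps)

lemma bern_diff: "bern T n (\<lambda>k. G k - H k) = bern T n G - bern T n H"
  using bern_add[of T n G "\<lambda>k. (-1) *\<^sub>R H k"] unfolding bern_scaleR by simp

lemma bern_const: "bern T n (\<lambda>k. X) = X"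
  by (induction n) (auto intro!: blinfun_eqI simp: blinfun.bilinear_simps)

lemma bern_compose_right: "bern T n (\<lambda>k. G k o\<^sub>L Z) = bern T n G o\<^sub>L Z"
  by (induction n arbitrary: G)
    (auto intro!: blinfun_eqI simp: blinfun.bilinear_simps)

lemma bern_commuting:
  assumes "commuting Z T" "\<And>k. commuting Z (G k)"
  shows "commuting Z (bern T n G)"
  using assms(2)
proof (induction n arbitrary: G)
  case (Suc n)
  note c = commutingD[OF Suc.IH[of G, OF Suc.prems]] commutingD[OF Suc.IH[of "\<lambda>k. G (Suc k)", OF Suc.prems]]
    commutingD[OF assms(1)]
  show ?case
    by (rule commutingI) (simp add: blinfun.bilinear_simps c)
qed simp

text \<open>The mean of the binomial distribution. A general factor \<open>X\<close> is carried
  because averaging over a second variable first leaves \<open>T\<close> as the coefficient of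
  \<open>k\<close>.\<close>

lemma bern_linear: "bern T n (\<lambda>k. real k *\<^sub>R X) = real n *\<^sub>R (T o\<^sub>L X)"
proof (induction n)
  case (Suc n)
  have step: "bern T n (\<lambda>k. real (Suc k) *\<^sub>R X) = bern T n (\<lambda>k. real k *\<^sub>R X) + X"
    by (simp add: scaleR_add_left bern_add bern_const add.commute)
  show ?case
    unfolding bern.simps step Suc
    by (rule blinfun_eqI) (simp add: blinfun.bilinear_simps algebra_simps)
qed simp

text \<open>The second moment of the binomial distribution; a success in the extra trial replaces
  \<open>k\<^sup>2\<close> by \<open>k\<^sup>2 + 2 k + 1\<close>.\<close>

lemma bern_square:
  "bern T n (\<lambda>k. (real k)\<^sup>2 *\<^sub>R X) =
     real n *\<^sub>R (T o\<^sub>L X) + (real n * (real n - 1)) *\<^sub>R (T o\<^sub>L (T o\<^sub>L X))"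
proof (induction n)
  case (Suc n)
  have step: "bern T n (\<lambda>k. (real (Suc k))\<^sup>2 *\<^sub>R X) =
      bern T n (\<lambda>k. (real k)\<^sup>2 *\<^sub>R X) + 2 *\<^sub>R bern T n (\<lambda>k. real k *\<^sub>R X) + X"
    unfolding bern_scaleR[symmetric]
    by (simp add: power2_eq_square algebra_simps bern_add bern_const scaleR_2)
  show ?case
    unfolding bern.simps step Suc bern_linear
    by (rule blinfun_eqI) (simp add: blinfun.bilinear_simps algebra_simps scaleR_mult_2)
qed simp

section \<open>Order estimates for Bernstein operators of a symmetric \<open>T\<close> with 0 \<le>
  \<open>T\<close> \<le> I\<close>

locale positive_contraction =
  fixes T :: "'a::{real_inner,banach} \<Rightarrow>\<^sub>L 'a"
  assumes symmetric: "is_adjoint T T"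
    and nonneg: "0 \<le> inner (T x) x"
    and le_one: "inner (T x) x \<le> (norm x)\<^sup>2"
begin

text \<open>
  Positive operators for which products with \<open>T\<close> and \<open>I - T\<close> stay positive. The product of
  commuting positive operators is positive, but the general proof needs square roots, i.e. the
  functional calculus under construction.
\<close>

definition cone :: "('a \<Rightarrow>\<^sub>L 'a) \<Rightarrow> bool" where
  "cone X \<longleftrightarrow> commuting X T \<and>
     (\<forall>x. 0 \<le> inner (T (X x)) x \<and> 0 \<le> inner (X x - T (X x)) x)"

text \<open>\<open>X\<close> is the sum of \<open>T X\<close> and \<open>X - T X\<close>, whose
  forms are both nonnegative.\<close>

lemma cone_nonneg: "cone X \<Longrightarrow> 0 \<le> inner (X x) x"
  unfolding cone_def by (smt (verit) inner_diff_left)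

lemma cone_scaleR_id: "0 \<le> r \<Longrightarrow> cone (r *\<^sub>R id_blinfun)"
  using nonneg le_one
  by (auto intro!: commutingI mult_nonneg_nonneg
      simp: cone_def blinfun.bilinear_simps inner_simps power2_norm_eq_inner simp flip: right_diff_distrib)

text \<open>For \<open>Z\<close> in the cone,
  \<open>T (I - T) Z = (I - T) (T Z) (I - T) + T ((I - T) Z) T\<close> is a sum of congruences of
  nonnegative operators; this is \<open>mixed\<close>. Multiplying the new operator by
  \<open>T\<close> or \<open>I - T\<close> gives one such term plus one of the congruences
  \<open>T Y T\<close> and \<open>(I - T) X (I - T)\<close>.\<close>

lemma cone_step:
  assumes X: "cone X" and Y: "cone Y"
  shows "cone (((id_blinfun - T) o\<^sub>L X) + (T o\<^sub>L Y))"
proof -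
  have cX: "X (T x) = T (X x)" and cY: "Y (T x) = T (Y x)" for x
    using X Y by (auto simp: cone_def commutingD)
  have s: "inner (T x) y = inner x (T y)" for x y
    using symmetric by (simp add: is_adjoint_def)
  have mixed: "0 \<le> inner (T (Z x) - T (T (Z x))) x" if Z: "cone Z" for Z x
  proof -
    have cZ: "Z (T x) = T (Z x)" for x using Z by (simp add: cone_def commutingD)
    have "0 \<le> inner (T (Z (x - T x))) (x - T x) + inner (Z (T x) - T (Z (T x))) (T x)"
      using Z unfolding cone_def by (meson add_nonneg_nonneg)
    also have "\<dots> = inner (T (Z x) - T (T (Z x))) x"
      by (simp add: blinfun.bilinear_simps inner_simps cZ s)
    finally show ?thesis .
  qed
  have "0 \<le> inner (T (X x - T (X x) + T (Y x))) x" for x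
  proof -
    have "0 \<le> inner (T (X x) - T (T (X x))) x + inner (T (Y (T x))) x + 0"
      using mixed[OF X, of x] cone_nonneg[OF Y, of "T x"] by (simp add: s cY)
    then show ?thesis by (simp add: blinfun.bilinear_simps inner_simps cY)
  qed
  moreover have "0 \<le> inner ((X x - T (X x) + T (Y x)) - T (X x - T (X x) + T (Y x))) x" for x
  proof -
    have "0 \<le> inner (X (x - T x)) (x - T x)" by (rule cone_nonneg[OF X])
    then have "0 \<le> inner (X (x - T x)) (x - T x) + inner (T (Y x) - T (T (Y x))) x"
      using mixed[OF Y, of x] by simp
    then show ?thesis by (simp add: blinfun.bilinear_simps inner_simps cX s)
  qed
  moreover have "commuting (((id_blinfun - T) o\<^sub>L X) + (T o\<^sub>L Y)) T"
    by (auto intro!: commutingI simp: blinfun.bilinear_simps cX cY)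
  ultimately show ?thesis by (simp add: cone_def blinfun.bilinear_simps)
qed

lemma cone_bern: "(\<And>k. k \<le> n \<Longrightarrow> cone (G k)) \<Longrightarrow> cone (bern T n G)"
proof (induction n arbitrary: G)
  case (Suc n)
  show ?case unfolding bern.simps
    by (rule cone_step; rule Suc.IH) (simp_all add: Suc.prems)
qed simp

text \<open>Taking adjoints reverses the products with \<open>T\<close> and \<open>I - T\<close>;
  the coefficients commute with \<open>T\<close>, so the original order can be restored.\<close>

lemma bern_symmetric:
  assumes "\<And>k. is_adjoint (G k) (G k)" "\<And>k. commuting (G k) T"
  shows "is_adjoint (bern T n G) (bern T n G)"
  using assms
proof (induction n arbitrary: G)
  case (Suc n)
  have comm: "commuting T (bern T n F)" if "\<And>k. commuting (F k) T" for F
    using that by (intro bern_commuting) (auto simp: eq_commute)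
  have "is_adjoint (bern T (Suc n) G)
      ((bern T n G o\<^sub>L (id_blinfun - T)) + (bern T n (\<lambda>k. G (Suc k)) o\<^sub>L T))"
    unfolding bern.simps by (intro is_adjoint_intros symmetric Suc)
  also have "(bern T n G o\<^sub>L (id_blinfun - T)) + (bern T n (\<lambda>k. G (Suc k)) o\<^sub>L T) = bern T (Suc n) G"
    by (rule blinfun_eqI) (simp add: blinfun.bilinear_simps
      commutingD[OF comm[of G]] commutingD[OF comm[of "\<lambda>k. G (Suc k)"]] Suc.prems(2))
  finally show ?case .
qed simp

text \<open>The average of \<open>F k l\<close> over independent binomial \<open>k\<close> and
  \<open>l\<close>. Two indices let Bernstein operators of different degrees, and products of them,
  be compared inside one average.\<close>

definition bern2 :: "nat \<Rightarrow> nat \<Rightarrow> (nat \<Rightarrow> nat \<Rightarrow> real) \<Rightarrow> ('a \<Rightarrow>\<^sub>L 'a)" where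
  "bern2 n m F = bern T n (\<lambda>k. bern T m (\<lambda>l. F k l *\<^sub>R id_blinfun))"

lemma bern2_symmetric: "is_adjoint (bern2 n m F) (bern2 n m F)"
proof -
  have id: "is_adjoint (r *\<^sub>R id_blinfun) (r *\<^sub>R id_blinfun)" "commuting Z (r *\<^sub>R id_blinfun)"
    for r and Z :: "'a \<Rightarrow>\<^sub>L 'a"
    by (auto intro!: is_adjoint_intros commutingI simp: blinfun.bilinear_simps)
  show ?thesis
    unfolding bern2_def by (intro bern_symmetric id sym[OF bern_commuting] sym[OF id(2)] refl)
qed

lemma bern2_add: "bern2 n m (\<lambda>k l. F k l + F' k l) = bern2 n m F + bern2 n m F'"
  by (simp add: bern2_def bern_add scaleR_add_left)

lemma bern2_diff: "bern2 n m (\<lambda>k l. F k l - F' k l) = bern2 n m F - bern2 n m F'"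
  by (simp add: bern2_def bern_diff scaleR_diff_left)

lemma bern2_nonneg:
  assumes "\<And>k l. k \<le> n \<Longrightarrow> l \<le> m \<Longrightarrow> 0 \<le> F k l"
  shows "0 \<le> inner (bern2 n m F x) x"
  unfolding bern2_def
  by (rule cone_nonneg, rule cone_bern, rule cone_bern, rule cone_scaleR_id, rule assms)

text \<open>
  Computed from the first two moments of the binomial distribution: \<open>k / n\<close> and \<open>l / m\<close> are
  independent, with common mean \<open>T\<close> and variances \<open>T (I - T) / n\<close> and \<open>T (I - T) / m\<close>.
\<close>

lemma bern2_variance:
  assumes "n > 0" "m > 0"
  shows "bern2 n m (\<lambda>k l. e + C * (real k / real n - real l / real m)\<^sup>2) =
    e *\<^sub>R id_blinfun + (C * (1 / n + 1 / m)) *\<^sub>R (T - (T o\<^sub>L T))"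
proof -
  have inner: "bern T m (\<lambda>l. (e + C * (a - real l / real m)\<^sup>2) *\<^sub>R id_blinfun) =
      (e + C * a\<^sup>2) *\<^sub>R id_blinfun - (2 * C * a) *\<^sub>R T +
      (C / m) *\<^sub>R T + (C * (1 - 1 / m)) *\<^sub>R (T o\<^sub>L T)" for a
  proof -
    have "bern T m (\<lambda>l. (e + C * (a - real l / real m)\<^sup>2) *\<^sub>R id_blinfun) =
      bern T m (\<lambda>l. (e + C * a\<^sup>2) *\<^sub>R id_blinfun - (2 * C * a / m) *\<^sub>R (real l *\<^sub>R id_blinfun) +
        (C / m\<^sup>2) *\<^sub>R ((real l)\<^sup>2 *\<^sub>R id_blinfun))"
    proof (intro arg_cong[where f = "bern T m"] ext)
      fix l
      have "e + C * (a - real l / real m)\<^sup>2 = e + C * a\<^sup>2 - 2 * C * a / m * l + C / m\<^sup>2 * (real l)\<^sup>2"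
        by (simp add: power2_diff power_divide algebra_simps)
      then show "(e + C * (a - real l / real m)\<^sup>2) *\<^sub>R id_blinfun =
          (e + C * a\<^sup>2) *\<^sub>R id_blinfun - (2 * C * a / m) *\<^sub>R (real l *\<^sub>R id_blinfun) +
          (C / m\<^sup>2) *\<^sub>R ((real l)\<^sup>2 *\<^sub>R id_blinfun)"
        by (simp only: scaleR_add_left scaleR_diff_left scaleR_scaleR)
    qed
    also have "\<dots> = (e + C * a\<^sup>2) *\<^sub>R id_blinfun - (2 * C * a) *\<^sub>R T +
      (C / m) *\<^sub>R T + (C * (1 - 1 / m)) *\<^sub>R (T o\<^sub>L T)"
      unfolding bern_add bern_diff bern_scaleR bern_linear bern_square bern_const
      using assms by (auto intro!: blinfun_eqI simp: blinfun.bilinear_simps algebra_simps power2_eq_square)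
    finally show ?thesis .
  qed
  have "bern2 n m (\<lambda>k l. e + C * (real k / real n - real l / real m)\<^sup>2) =
    bern T n (\<lambda>k. (e *\<^sub>R id_blinfun + (C / m) *\<^sub>R T + (C * (1 - 1 / m)) *\<^sub>R (T o\<^sub>L T)) +
       (C / n\<^sup>2) *\<^sub>R ((real k)\<^sup>2 *\<^sub>R id_blinfun) - (2 * C / n) *\<^sub>R (real k *\<^sub>R T))"
    unfolding bern2_def inner
    by (rule arg_cong[where f = "bern T n"])
      (auto simp: fun_eq_iff algebra_simps power_divide)
  also have "\<dots> = e *\<^sub>R id_blinfun + (C * (1 / n + 1 / m)) *\<^sub>R (T - (T o\<^sub>L T))"
    unfolding bern_add bern_diff bern_scaleR bern_linear bern_square bern_const
    using assms by (auto intro!: blinfun_eqI simp: blinfun.bilinear_simps algebra_simps power2_eq_square scaleR_mult_2)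
  finally show ?thesis .
qed

text \<open>Chebyshev's argument: \<open>F\<close> lies between minus and plus a quadratic majorant,
  positivity of the average carries this over to quadratic forms, and the average of the majorant is
  known from the variances.\<close>

lemma norm_bern2_le:
  assumes nm: "n > 0" "m > 0" and "0 \<le> e" "0 \<le> C"
    and F: "\<And>k l. k \<le> n \<Longrightarrow> l \<le> m \<Longrightarrow> \<bar>F k l\<bar> \<le> e + C * (real k / real n - real l / real m)\<^sup>2"
  shows "norm (bern2 n m F) \<le> e + C * (1 / n + 1 / m)"
proof (rule symmetric_norm_le[OF bern2_symmetric])
  show "0 \<le> e + C * (1 / n + 1 / m)" using assms by simp
next
  fix x
  let ?H = "\<lambda>k l. e + C * (real k / real n - real l / real m)\<^sup>2"
  have "0 \<le> inner (bern2 n m (\<lambda>k l. ?H k l - F k l) x) x"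
    by (rule bern2_nonneg) (smt (verit) F)
  moreover have "0 \<le> inner (bern2 n m (\<lambda>k l. ?H k l + F k l) x) x"
    by (rule bern2_nonneg) (smt (verit) F)
  ultimately have "\<bar>inner (bern2 n m F x) x\<bar> \<le> inner (blinfun_apply (bern2 n m ?H) x) x"
    unfolding bern2_diff bern2_add[of n m ?H F] by (simp add: blinfun.bilinear_simps inner_simps)
  also have "\<dots> = e * (norm x)\<^sup>2 + (C * (1 / real n + 1 / real m)) *
      (inner (blinfun_apply T x) x - inner (blinfun_apply T x) (blinfun_apply T x))"
    unfolding bern2_variance[OF nm]
    using symmetric by (simp add: blinfun.bilinear_simps inner_simps power2_norm_eq_inner is_adjoint_def)
  \<comment> \<open>The form of \<open>T - T\<^sup>2\<close> is at most that of \<open>T\<close>,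
    hence at most that of the identity.\<close>
  also have "\<dots> \<le> e * (norm x)\<^sup>2 + (C * (1 / real n + 1 / real m)) * (norm x)\<^sup>2"
    using le_one[of x] \<open>0 \<le> C\<close> by (intro add_left_mono mult_left_mono) (auto intro: order_trans[rotated])
  finally show "\<bar>inner (bern2 n m F x) x\<bar> \<le> (e + C * (1 / real n + 1 / real m)) * (norm x)\<^sup>2"
    by (simp add: algebra_simps)
qed

end

section \<open>Functions of \<open>T\<close> as norm limits of Bernstein operators\<close>

lemma continuous_quadratic_modulus:
  fixes f :: "real \<Rightarrow> real"
  assumes f: "continuous_on {0..1} f" and "0 < e"
  obtains C where "0 \<le> C"
    "\<And>x y. x \<in> {0..1} \<Longrightarrow> y \<in> {0..1} \<Longrightarrow> \<bar>f x - f y\<bar> \<le> e + C * (x - y)\<^sup>2"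
proof -
  obtain d where d: "d > 0" "\<And>x y. x \<in> {0..1} \<Longrightarrow> y \<in> {0..1} \<Longrightarrow> dist y x < d \<Longrightarrow> dist (f y) (f x) < e"
    using compact_uniformly_continuous[OF f compact_Icc] \<open>0 < e\<close>
    unfolding uniformly_continuous_on_def by metis
  obtain M where M: "\<And>x. x \<in> {0..1} \<Longrightarrow> \<bar>f x\<bar> \<le> M"
    using compact_imp_bounded[OF compact_continuous_image[OF f compact_Icc]]
    unfolding bounded_iff by (metis imageI real_norm_def)
  have "0 \<le> M" using M[of 0] by auto
  \<comment> \<open>Uniform continuity handles points closer than \<open>d\<close>. Farther apart,
    \<open>(x - y)\<^sup>2 / d\<^sup>2\<close> is at least 1, so the quadratic term dominates the
    total oscillation, at most \<open>2 * M\<close>.\<close>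
  have "\<bar>f x - f y\<bar> \<le> e + (2 * M / d\<^sup>2) * (x - y)\<^sup>2" if "x \<in> {0..1}" "y \<in> {0..1}" for x y
  proof (cases "dist y x < d")
    case True
    then have "\<bar>f x - f y\<bar> \<le> e" using d(2)[of x y] that by (simp add: dist_real_def abs_minus_commute)
    moreover have "0 \<le> (2 * M / d\<^sup>2) * (x - y)\<^sup>2" using \<open>0 \<le> M\<close> by simp
    ultimately show ?thesis by linarith
  next
    case False
    then have "d\<^sup>2 \<le> (x - y)\<^sup>2"
      using \<open>d > 0\<close> by (simp add: dist_real_def abs_minus_commute abs_le_square_iff[symmetric])
    then have "2 * M * 1 \<le> 2 * M * ((x - y)\<^sup>2 / d\<^sup>2)"
      using \<open>d > 0\<close> \<open>0 \<le> M\<close> by (intro mult_left_mono) auto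
    moreover have "\<bar>f x - f y\<bar> \<le> 2 * M" using M[OF that(1)] M[OF that(2)] by linarith
    ultimately show ?thesis using \<open>0 < e\<close> by simp
  qed
  then show thesis
    using that[of "2 * M / d\<^sup>2"] \<open>0 \<le> M\<close> by simp
qed

context positive_contraction
begin

text \<open>The Bernstein polynomial of \<open>f\<close>, evaluated at \<open>T\<close>. For
  \<open>n = 0\<close> the quotient is 0 and the value is \<open>f 0\<close> times the
  identity.\<close>

definition bernstein :: "nat \<Rightarrow> (real \<Rightarrow> real) \<Rightarrow> ('a \<Rightarrow>\<^sub>L 'a)" where
  "bernstein n f = bern T n (\<lambda>k. f (real k / real n) *\<^sub>R id_blinfun)"

definition fcalc :: "(real \<Rightarrow> real) \<Rightarrow> ('a \<Rightarrow>\<^sub>L 'a)" where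
  "fcalc f = lim (\<lambda>n. bernstein n f)"

lemma bernstein_eq_bern2:
  "bernstein n f = bern2 n m (\<lambda>k l. f (real k / real n))"
  "bernstein m f = bern2 n m (\<lambda>k l. f (real l / real m))"
  by (simp_all add: bernstein_def bern2_def bern_const)

lemma real_divide_mem_unit: "k \<le> n \<Longrightarrow> real k / real n \<in> {0..1}"
  by (auto simp: divide_le_eq_1)

text \<open>Both degrees are averages over one pair of indices, so their difference is the average
  of \<open>f (k / n) - f (l / m)\<close>. The two quotients have the same mean and small variances,
  which makes the sequence Cauchy.\<close>

lemma fcalc_tendsto:
  assumes f: "continuous_on {0..1} f"
  shows "(\<lambda>n. bernstein n f) \<longlonglongrightarrow> fcalc f"
proof -
  have "Cauchy (\<lambda>n. bernstein n f)"
  proof (rule metric_CauchyI)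
    fix e :: real assume "0 < e"
    then have "0 < e / 2" by simp
    then obtain C where C: "0 \<le> C"
      "\<And>x y. x \<in> {0..1} \<Longrightarrow> y \<in> {0..1} \<Longrightarrow> \<bar>f x - f y\<bar> \<le> e / 2 + C * (x - y)\<^sup>2"
      using continuous_quadratic_modulus[OF f] by blast
    \<comment> \<open>Chosen so that \<open>C * (1 / N + 1 / N) < e / 2\<close>.\<close>
    obtain N :: nat where N: "4 * C / e < real N" using reals_Archimedean2 by blast
    moreover have "0 \<le> 4 * C / e" using C \<open>0 < e\<close> by simp
    ultimately have "0 < N" by linarith
    have "dist (bernstein n f) (bernstein m f) < e" if "n \<ge> N" "m \<ge> N" for n m
    proof -
      have "dist (bernstein n f) (bernstein m f) =
          norm (bern2 n m (\<lambda>k l. f (real k / real n) - f (real l / real m)))"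
        unfolding dist_norm bern2_diff bernstein_eq_bern2(1)[of n f m] bernstein_eq_bern2(2)[of m f n] ..
      also have "\<dots> \<le> e / 2 + C * (1 / n + 1 / m)"
        using that \<open>0 < N\<close> \<open>0 < e\<close> C by (intro norm_bern2_le C real_divide_mem_unit) auto
      also have "\<dots> \<le> e / 2 + C * (1 / N + 1 / N)"
        using that \<open>0 < N\<close> by (intro add_left_mono mult_left_mono add_mono C(1)) (auto simp: frac_le)
      also have "\<dots> < e" using N \<open>0 < N\<close> \<open>0 < e\<close> by (simp add: field_simps)
      finally show ?thesis .
    qed
    then show "\<exists>M. \<forall>m\<ge>M. \<forall>n\<ge>M. dist (bernstein m f) (bernstein n f) < e" by blast
  qed
  then show ?thesis
    unfolding fcalc_def by (simp add: Cauchy_convergent_iff convergent_LIMSEQ_iff)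
qed

lemma fcalc_add:
  assumes "continuous_on {0..1} f" "continuous_on {0..1} g"
  shows "fcalc (\<lambda>x. f x + g x) = fcalc f + fcalc g"
proof (rule LIMSEQ_unique[OF fcalc_tendsto])
  show "(\<lambda>n. bernstein n (\<lambda>x. f x + g x)) \<longlonglongrightarrow> fcalc f + fcalc g"
    using tendsto_add[OF fcalc_tendsto[OF assms(1)] fcalc_tendsto[OF assms(2)]]
    by (simp add: bernstein_def scaleR_add_left bern_add)
qed (intro continuous_intros assms)

lemma fcalc_scaleR:
  assumes "continuous_on {0..1} f"
  shows "fcalc (\<lambda>x. c * f x) = c *\<^sub>R fcalc f"
proof (rule LIMSEQ_unique[OF fcalc_tendsto])
  show "(\<lambda>n. bernstein n (\<lambda>x. c * f x)) \<longlonglongrightarrow> c *\<^sub>R fcalc f"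
    using tendsto_scaleR[OF tendsto_const fcalc_tendsto[OF assms], of c]
    by (simp add: bernstein_def bern_scaleR flip: scaleR_scaleR)
qed (intro continuous_intros assms)

lemma fcalc_diff:
  assumes "continuous_on {0..1} f" "continuous_on {0..1} g"
  shows "fcalc (\<lambda>x. f x - g x) = fcalc f - fcalc g"
  using fcalc_add[OF assms(1), of "\<lambda>x. (-1) * g x"] fcalc_scaleR[OF assms(2), of "-1"]
  by (simp add: continuous_intros assms)

lemma fcalc_const: "fcalc (\<lambda>x. c) = c *\<^sub>R id_blinfun"
  by (simp add: fcalc_def bernstein_def bern_const)

lemma fcalc_ident: "fcalc (\<lambda>x. x) = T"
proof (rule LIMSEQ_unique[OF fcalc_tendsto])
  \<comment> \<open>The mean of \<open>k / n\<close> is exactly \<open>T\<close>; for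
    \<open>n = 0\<close> the value is 0, hence the restriction.\<close>
  have "bernstein n (\<lambda>x. x) = T" if "n > 0" for n
  proof -
    have "bernstein n (\<lambda>x. x) = bern T n (\<lambda>k. (1 / real n) *\<^sub>R (real k *\<^sub>R id_blinfun))"
      by (simp add: bernstein_def)
    also have "\<dots> = T"
      unfolding bern_scaleR bern_linear using that
      by (intro blinfun_eqI) (simp add: blinfun.bilinear_simps)
    finally show ?thesis .
  qed
  then show "(\<lambda>n. bernstein n (\<lambda>x. x)) \<longlonglongrightarrow> T"
    by (intro tendsto_eventually) (auto simp: eventually_sequentially intro!: exI[of _ 1])
qed (intro continuous_intros)

lemma fcalc_symmetric:
  assumes "continuous_on {0..1} f"
  shows "is_adjoint (fcalc f) (fcalc f)"
proof (rule is_adjoint_LIMSEQ[OF _ fcalc_tendsto[OF assms]])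
  show "is_adjoint (bernstein n f) (bernstein n f)" for n
    unfolding bernstein_eq_bern2(1)[of n f 0] by (rule bern2_symmetric)
qed

lemma commuting_fcalc:
  assumes "continuous_on {0..1} f" "commuting Z T"
  shows "commuting Z (fcalc f)"
proof (rule commuting_LIMSEQ[OF _ fcalc_tendsto[OF assms(1)]])
  show "commuting Z (bernstein n f)" for n
    unfolding bernstein_def
    by (rule bern_commuting[OF assms(2)]) (auto intro!: commutingI simp: blinfun.bilinear_simps)
qed

lemma norm_fcalc_le:
  assumes "continuous_on {0..1} f" "\<And>x. x \<in> {0..1} \<Longrightarrow> \<bar>f x\<bar> \<le> K"
  shows "norm (fcalc f) \<le> K"
proof (rule LIMSEQ_le_const2[OF tendsto_norm[OF fcalc_tendsto[OF assms(1)]]])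
  have "0 \<le> K" using assms(2)[of 0] by simp
  \<comment> \<open>The majorant is the constant \<open>K\<close>, with quadratic coefficient
    0.\<close>
  have "norm (bernstein n f) \<le> K" if "n > 0" for n
    using norm_bern2_le[OF that that \<open>0 \<le> K\<close> order_refl, of "\<lambda>k l. f (real k / real n)"]
      assms(2)[OF real_divide_mem_unit]
    by (simp add: bernstein_eq_bern2(1)[of n f n])
  then show "\<exists>N. \<forall>n\<ge>N. norm (bernstein n f) \<le> K" by (intro exI[of _ 1]) auto
qed

lemma fcalc_cong:
  assumes "continuous_on {0..1} f" "\<And>x. x \<in> {0..1} \<Longrightarrow> f x = g x"
  shows "fcalc f = fcalc g"
proof -
  have g: "continuous_on {0..1} g"
    using assms continuous_on_cong by metis
  have "norm (fcalc (\<lambda>x. f x - g x)) \<le> 0"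
    using assms g by (intro norm_fcalc_le) (auto intro!: continuous_intros)
  then show ?thesis using fcalc_diff[OF assms(1) g] by simp
qed

lemma bernstein_compose:
  "bernstein n f o\<^sub>L bernstein m g = bern2 n m (\<lambda>k l. f (real k / real n) * g (real l / real m))"
proof -
  have "bernstein n f o\<^sub>L bernstein m g = bern T n (\<lambda>k. f (real k / real n) *\<^sub>R bernstein m g)"
    unfolding bernstein_def bern_compose_right[symmetric]
    by (rule arg_cong[where f = "bern T n"])
      (auto intro!: blinfun_eqI simp: fun_eq_iff blinfun.bilinear_simps)
  then show ?thesis
    by (simp add: bernstein_def[of m] bern2_def bern_scaleR[symmetric])
qed

text \<open>The product of two Bernstein operators averages \<open>f (k / n) * g (l / n)\<close>
  over independent indices, the operator of the product averages
  \<open>f (k / n) * g (k / n)\<close>. The difference is governed by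
  \<open>g (k / n) - g (l / n)\<close>, which the quadratic modulus of \<open>g\<close> makes small
  on average.\<close>

lemma fcalc_mult:
  assumes f: "continuous_on {0..1} f" and g: "continuous_on {0..1} g"
  shows "fcalc (\<lambda>x. f x * g x) = fcalc f o\<^sub>L fcalc g"
proof (rule LIMSEQ_unique[OF fcalc_tendsto])
  obtain M0 where M0: "\<And>x. x \<in> {0..1} \<Longrightarrow> \<bar>f x\<bar> \<le> M0"
    using compact_imp_bounded[OF compact_continuous_image[OF f compact_Icc]]
    unfolding bounded_iff by (metis imageI real_norm_def)
  \<comment> \<open>Adding 1 keeps the bound positive, so that \<open>e\<close> can be divided by
    it.\<close>
  define M where "M = M0 + 1"
  have M: "\<bar>f x\<bar> \<le> M" if "x \<in> {0..1}" for x using M0[OF that] by (simp add: M_def)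
  have "0 < M" using M0[of 0] by (simp add: M_def)
  have "(\<lambda>n. bernstein n (\<lambda>x. f x * g x) - (bernstein n f o\<^sub>L bernstein n g)) \<longlonglongrightarrow> 0"
  proof (rule LIMSEQ_I)
    fix e :: real assume "0 < e"
    then have "0 < e / (2 * M)" using \<open>0 < M\<close> by simp
    then obtain C where C: "0 \<le> C"
      "\<And>x y. x \<in> {0..1} \<Longrightarrow> y \<in> {0..1} \<Longrightarrow> \<bar>g x - g y\<bar> \<le> e / (2 * M) + C * (x - y)\<^sup>2"
      using continuous_quadratic_modulus[OF g] by blast
    obtain N :: nat where N: "4 * (M * C) / e < real N" using reals_Archimedean2 by blast
    moreover have "0 \<le> 4 * (M * C) / e" using C \<open>0 < e\<close> \<open>0 < M\<close> by simp
    ultimately have "0 < N" by linarith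
    have "norm (bernstein n (\<lambda>x. f x * g x) - (bernstein n f o\<^sub>L bernstein n g) - 0) < e"
      if "n \<ge> N" for n
    proof -
      have "bernstein n (\<lambda>x. f x * g x) - (bernstein n f o\<^sub>L bernstein n g) =
          bern2 n n (\<lambda>k l. f (real k / real n) * g (real k / real n) - f (real k / real n) * g (real l / real n))"
        unfolding bern2_diff bernstein_compose bernstein_eq_bern2(1)[of n "\<lambda>x. f x * g x" n] ..
      also have "norm \<dots> \<le> e / 2 + (M * C) * (1 / n + 1 / n)"
      proof (rule norm_bern2_le)
        fix k l assume kl: "k \<le> n" "l \<le> n"
        let ?x = "real k / real n" and ?y = "real l / real n"
        have "\<bar>f ?x * g ?x - f ?x * g ?y\<bar> = \<bar>f ?x\<bar> * \<bar>g ?x - g ?y\<bar>"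
          by (simp flip: abs_mult right_diff_distrib)
        also have "\<dots> \<le> M * (e / (2 * M) + C * (?x - ?y)\<^sup>2)"
          using \<open>0 < M\<close> by (intro mult_mono M C real_divide_mem_unit kl) auto
        also have "\<dots> = e / 2 + M * C * (?x - ?y)\<^sup>2"
          using \<open>0 < M\<close> by (simp add: field_simps)
        finally show "\<bar>f ?x * g ?x - f ?x * g ?y\<bar> \<le> e / 2 + M * C * (?x - ?y)\<^sup>2" .
      qed (use that \<open>0 < N\<close> \<open>0 < e\<close> \<open>0 < M\<close> C in auto)
      also have "\<dots> \<le> e / 2 + (M * C) * (1 / N + 1 / N)"
        using that \<open>0 < N\<close> \<open>0 < M\<close> C(1) by (intro add_left_mono mult_left_mono add_mono) (auto simp: frac_le)
      also have "\<dots> < e" using N \<open>0 < N\<close> \<open>0 < e\<close> by (simp add: field_simps)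
      finally show ?thesis by simp
    qed
    then show "\<exists>N. \<forall>n\<ge>N. norm (bernstein n (\<lambda>x. f x * g x) - (bernstein n f o\<^sub>L bernstein n g) - 0) < e"
      by blast
  qed
  moreover have "(\<lambda>n. bernstein n f o\<^sub>L bernstein n g) \<longlonglongrightarrow> (fcalc f o\<^sub>L fcalc g)"
    by (intro bounded_bilinear.tendsto[OF bounded_bilinear_blinfun_compose] fcalc_tendsto f g)
  ultimately show "(\<lambda>n. bernstein n (\<lambda>x. f x * g x)) \<longlonglongrightarrow> (fcalc f o\<^sub>L fcalc g)"
    using tendsto_add by fastforce
qed (intro continuous_intros f g)

end

section \<open>Differentiating functions of \<open>T\<close> in a parameter\<close>

lemma quadratic_remainder:
  fixes f f' :: "real \<Rightarrow> real"
  assumes f: "\<And>x. (f has_real_derivative f' x) (at x)" and lip: "\<And>x y. \<bar>f' x - f' y\<bar> \<le> \<bar>x - y\<bar>"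
  shows "\<bar>f b - f a - (b - a) * f' a\<bar> \<le> (b - a)\<^sup>2"
proof -
  \<comment> \<open>The mean value inequality for \<open>f x - x * f' a\<close>, whose derivative
    \<open>f' z - f' a\<close> is at most \<open>\<bar>b - a\<bar>\<close> in size on the
    ball.\<close>
  have "norm ((f b - b * f' a) - (f a - a * f' a)) \<le> \<bar>b - a\<bar> * norm (b - a)"
  proof (rule field_differentiable_bound[where S = "cball a \<bar>b - a\<bar>"])
    fix z assume "z \<in> cball a \<bar>b - a\<bar>"
    then have "\<bar>z - a\<bar> \<le> \<bar>b - a\<bar>" by (simp add: dist_real_def abs_minus_commute)
    then show "norm (f' z - f' a) \<le> \<bar>b - a\<bar>" using lip[of z a] by simp
    show "((\<lambda>x. f x - x * f' a) has_field_derivative f' z - f' a) (at z within cball a \<bar>b - a\<bar>)"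
      by (auto intro!: derivative_eq_intros has_field_derivative_at_within[OF f])
  qed (auto simp: dist_real_def abs_minus_commute)
  then show ?thesis by (simp add: power2_eq_square algebra_simps flip: abs_mult)
qed

lemma sin_lipschitz: "\<bar>sin x - sin y\<bar> \<le> \<bar>x - (y::real)\<bar>"
proof -
  have "\<bar>sin x - sin y\<bar> = 2 * \<bar>sin ((x - y) / 2)\<bar> * \<bar>cos ((x + y) / 2)\<bar>"
    by (simp add: sin_diff_sin abs_mult)
  also have "\<dots> \<le> 2 * \<bar>(x - y) / 2\<bar> * 1"
    by (intro mult_mono abs_sin_x_le_abs_x) auto
  finally show ?thesis by simp
qed

lemma cos_lipschitz: "\<bar>cos x - cos y\<bar> \<le> \<bar>x - (y::real)\<bar>"
  using sin_lipschitz[of "pi / 2 - y" "pi / 2 - x"] by (simp add: sin_diff abs_minus_commute)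

context positive_contraction
begin

text \<open>A supremum bound on the unit interval bounds the norm of \<open>fcalc\<close>, so a
  uniform quadratic remainder becomes one in operator norm.\<close>

lemma fcalc_has_vector_derivative:
  assumes f: "\<And>t. continuous_on {0..1} (f t)" and f': "continuous_on {0..1} f'"
    and bound: "\<And>s x. x \<in> {0..1} \<Longrightarrow> \<bar>f s x - f t x - (s - t) * f' x\<bar> \<le> K * (s - t)\<^sup>2"
  shows "((\<lambda>t. fcalc (f t)) has_vector_derivative fcalc f') (at t)"
  unfolding has_vector_derivative_def has_derivative_within_alt
proof (intro conjI allI impI)
  show "bounded_linear (\<lambda>s. s *\<^sub>R fcalc f')" by (rule bounded_linear_scaleR_left)
  have "0 \<le> K" using bound[of 0 "t + 1"] by simp
  fix e :: real assume "0 < e"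
  have "norm (fcalc (f s) - fcalc (f t) - (s - t) *\<^sub>R fcalc f') \<le> e * norm (s - t)"
    if s: "norm (s - t) < e / (K + 1)" for s
  proof -
    have "fcalc (f s) - fcalc (f t) - (s - t) *\<^sub>R fcalc f' = fcalc (\<lambda>x. f s x - f t x - (s - t) * f' x)"
      using f f' by (simp add: fcalc_diff fcalc_scaleR continuous_intros)
    also have "norm \<dots> \<le> K * (s - t)\<^sup>2"
      by (intro norm_fcalc_le bound continuous_intros f f')
    also have "\<dots> \<le> (K * norm (s - t)) * norm (s - t)"
      by (simp add: power2_eq_square mult.assoc flip: abs_mult)
    also have "\<dots> \<le> e * norm (s - t)"
    proof (intro mult_right_mono)
      have "(K + 1) * norm (s - t) \<le> e" using s \<open>0 \<le> K\<close> by (simp add: field_simps)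
      then show "K * norm (s - t) \<le> e" using norm_ge_zero[of "s - t"] by (simp add: distrib_right)
    qed simp
    finally show ?thesis .
  qed
  moreover have "0 < e / (K + 1)" using \<open>0 < e\<close> \<open>0 \<le> K\<close> by simp
  ultimately show "\<exists>d>0. \<forall>s\<in>UNIV. norm (s - t) < d \<longrightarrow>
      norm (fcalc (f s) - fcalc (f t) - (s - t) *\<^sub>R fcalc f') \<le> e * norm (s - t)"
    by blast
qed

text \<open>These equations take the place of an exponential series: if
  \<open>W\<^sup>2 = - I\<close> and \<open>W\<close> commutes with \<open>T\<close>, they make
  cosine plus \<open>W\<close> times sine the solution of a linear flow. The Taylor remainder is at
  most \<open>(h x)\<^sup>2 (s - t)\<^sup>2\<close>, and \<open>h\<close> is bounded.\<close>

lemma fcalc_cos_sin_derivative: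
  assumes h: "continuous_on {0..1} h"
  shows "((\<lambda>t. fcalc (\<lambda>x. cos (t * h x))) has_vector_derivative
      - (fcalc h o\<^sub>L fcalc (\<lambda>x. sin (t * h x)))) (at t)"
    and "((\<lambda>t. fcalc (\<lambda>x. sin (t * h x))) has_vector_derivative
      (fcalc h o\<^sub>L fcalc (\<lambda>x. cos (t * h x)))) (at t)"
proof -
  obtain M where M: "\<And>x. x \<in> {0..1} \<Longrightarrow> \<bar>h x\<bar> \<le> M"
    using compact_imp_bounded[OF compact_continuous_image[OF h compact_Icc]]
    unfolding bounded_iff by (metis imageI real_norm_def)
  have scaled: "(s * h x - t * h x)\<^sup>2 \<le> M\<^sup>2 * (s - t)\<^sup>2" if "x \<in> {0..1}" for s x
  proof -
    have "(s * h x - t * h x)\<^sup>2 = \<bar>h x\<bar>\<^sup>2 * (s - t)\<^sup>2"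
      by (simp flip: left_diff_distrib add: power_mult_distrib)
    also have "\<dots> \<le> M\<^sup>2 * (s - t)\<^sup>2"
      using M[OF that] by (intro mult_right_mono power_mono) auto
    finally show ?thesis .
  qed
  have c: "continuous_on {0..1} (\<lambda>x. cos (s * h x))" "continuous_on {0..1} (\<lambda>x. sin (s * h x))" for s
    by (intro continuous_intros h)+
  have "((\<lambda>t. fcalc (\<lambda>x. cos (t * h x))) has_vector_derivative
      fcalc (\<lambda>x. - 1 * (h x * sin (t * h x)))) (at t)"
  proof (rule fcalc_has_vector_derivative[where K = "M\<^sup>2"])
    show "\<bar>cos (s * h x) - cos (t * h x) - (s - t) * (- 1 * (h x * sin (t * h x)))\<bar> \<le> M\<^sup>2 * (s - t)\<^sup>2"
      if "x \<in> {0..1}" for s x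
    proof -
      have "\<bar>cos (s * h x) - cos (t * h x) - (s * h x - t * h x) * (- sin (t * h x))\<bar> \<le> (s * h x - t * h x)\<^sup>2"
        by (rule quadratic_remainder[where f = cos and f' = "\<lambda>x. - sin x"])
          (auto intro!: derivative_eq_intros simp: sin_lipschitz abs_minus_commute)
      with scaled[OF that, of s] show ?thesis by (simp add: algebra_simps)
    qed
  qed (intro continuous_intros h)+
  then show "((\<lambda>t. fcalc (\<lambda>x. cos (t * h x))) has_vector_derivative
      - (fcalc h o\<^sub>L fcalc (\<lambda>x. sin (t * h x)))) (at t)"
    unfolding fcalc_scaleR[OF continuous_on_mult[OF h c(2)]] fcalc_mult[OF h c(2)] by simp
  have "((\<lambda>t. fcalc (\<lambda>x. sin (t * h x))) has_vector_derivative
      fcalc (\<lambda>x. h x * cos (t * h x))) (at t)"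
  proof (rule fcalc_has_vector_derivative[where K = "M\<^sup>2"])
    show "\<bar>sin (s * h x) - sin (t * h x) - (s - t) * (h x * cos (t * h x))\<bar> \<le> M\<^sup>2 * (s - t)\<^sup>2"
      if "x \<in> {0..1}" for s x
    proof -
      have "\<bar>sin (s * h x) - sin (t * h x) - (s * h x - t * h x) * cos (t * h x)\<bar> \<le> (s * h x - t * h x)\<^sup>2"
        by (rule quadratic_remainder[where f = sin and f' = cos])
          (auto intro!: derivative_eq_intros simp: cos_lipschitz)
      with scaled[OF that, of s] show ?thesis by (simp add: algebra_simps)
    qed
  qed (intro continuous_intros h)+
  then show "((\<lambda>t. fcalc (\<lambda>x. sin (t * h x))) has_vector_derivative
      (fcalc h o\<^sub>L fcalc (\<lambda>x. cos (t * h x)))) (at t)"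
    unfolding fcalc_mult[OF h c(1)] .
qed

end

section \<open>Signs of symmetric operators\<close>

text \<open>
  The projection onto the kernel is the strong limit of \<open>(I - N\<^sup>2 / \<parallel>N\<parallel>\<^sup>2)\<^sup>n\<close>; this yields the
  commutation property directly.
\<close>

lemma kernel_projection:
  fixes N :: "'a::{real_inner,banach} \<Rightarrow>\<^sub>L 'a"
  assumes N: "is_adjoint N N"
  obtains P where "is_adjoint P P" "P o\<^sub>L P = P" "N o\<^sub>L P = 0"
    "\<And>X. commuting X N \<Longrightarrow> commuting X P"
    "\<And>X :: 'a \<Rightarrow>\<^sub>L 'a. N o\<^sub>L X = 0 \<Longrightarrow> P o\<^sub>L X = X"
proof -
  \<comment> \<open>For \<open>N = 0\<close> the quotient is 0 and \<open>A\<close> is the identity.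
    In every case 0 \<le> \<open>A\<close> \<le> I.\<close>
  define r where "r = 1 / (norm N)\<^sup>2"
  define A where "A = id_blinfun - r *\<^sub>R (N o\<^sub>L N)"
  have "0 \<le> r" by (simp add: r_def)
  have N': "inner (N x) y = inner x (N y)" for x y using N by (simp add: is_adjoint_def)
  have Asym: "inner (A x) y = inner x (A y)" for x y
    by (simp add: A_def blinfun.bilinear_simps inner_simps N')
  have comp_le: "r * (norm (N x))\<^sup>2 \<le> (norm x)\<^sup>2" for x
  proof (cases "N = 0")
    case False
    have "(norm (N x))\<^sup>2 \<le> (norm N * norm x)\<^sup>2" by (intro power_mono norm_blinfun) simp
    then show ?thesis using False by (simp add: r_def power_mult_distrib divide_le_eq mult.commute)
  qed (simp add: r_def)
  have A_inner: "inner (A x) x = (norm x)\<^sup>2 - r * (norm (N x))\<^sup>2" for x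
    by (simp add: A_def blinfun.bilinear_simps inner_simps power2_norm_eq_inner symmetric_square_inner[OF N])
  have A_nonneg: "0 \<le> inner (A x) x" for x using comp_le[of x] by (simp add: A_inner)
  have A_decr: "inner (A x) x \<le> inner x x" for x
    using \<open>0 \<le> r\<close> by (simp add: A_inner power2_norm_eq_inner)
  have AN: "A (N x) = N (A x)" for x by (simp add: A_def blinfun.bilinear_simps)
  \<comment> \<open>\<open>A - A\<^sup>2 = A (I - A) = r N A N\<close>, which is nonnegative because
    \<open>A\<close> is.\<close>
  have A_decr2: "inner (A x) (A x) \<le> inner (A x) x" for x
  proof -
    have "inner (A x) x - inner (A x) (A x) = r * inner (A (N x)) (N x)"
    proof -
      have "x - A x = r *\<^sub>R N (N x)" by (simp add: A_def blinfun.bilinear_simps)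
      then have "inner (A x) x - inner (A x) (A x) = inner (A x) (r *\<^sub>R N (N x))"
        by (metis inner_diff_right)
      then show ?thesis by (simp add: AN N')
    qed
    then show ?thesis using mult_nonneg_nonneg[OF \<open>0 \<le> r\<close> A_nonneg[of "N x"]] by simp
  qed
  define p where "p n x = (blinfun_apply A ^^ n) x" for n x
  have p0: "p 0 x = x" and pSuc: "p (Suc n) x = A (p n x)" for n x by (simp_all add: p_def)
  have p_shift: "inner (p n x) (p m y) = inner (p (n + m) x) y" for n m x y
  proof (induction m arbitrary: n)
    case (Suc m)
    have "inner (p n x) (p (Suc m) y) = inner (p (Suc n) x) (p m y)" by (simp add: pSuc Asym)
    then show ?case by (simp add: Suc)
  qed (simp add: p0)
  have p_lin: "p n (x + y) = p n x + p n y" "p n (c *\<^sub>R x) = c *\<^sub>R p n x" for n x y c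
    by (induction n) (simp_all add: p0 pSuc blinfun.bilinear_simps)
  \<comment> \<open>Moving half of the factors across by symmetry reduces even powers to
    \<open>A \<le> I\<close>, and odd powers to \<open>0 \<le> A\<close> and
    \<open>A\<^sup>2 \<le> A\<close>.\<close>
  have nonneg: "0 \<le> inner (p n x) x" and decr: "inner (p (Suc n) x) x \<le> inner (p n x) x" for n x
  proof -
    have "(\<exists>k. n = k + k) \<or> (\<exists>k. n = Suc (k + k))"
      by presburger
    then have "0 \<le> inner (p n x) x \<and> inner (p (Suc n) x) x \<le> inner (p n x) x"
    proof (elim disjE exE)
      fix k assume n: "n = k + k"
      show ?thesis
        using A_decr[of "p k x"] p_shift[of k x k x] p_shift[of "Suc k" x k x]
        by (simp add: n pSuc) (metis inner_ge_zero)
    next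
      fix k assume n: "n = Suc (k + k)"
      show ?thesis
        using A_nonneg[of "p k x"] A_decr2[of "p k x"] p_shift[of "Suc k" x k x] p_shift[of "Suc k" x "Suc k" x]
        by (simp add: n pSuc)
    qed
    then show "0 \<le> inner (p n x) x" "inner (p (Suc n) x) x \<le> inner (p n x) x" by auto
  qed
  have norm_p: "norm (p n x) \<le> norm x" for n x
  proof -
    have "decseq (\<lambda>n. inner (p n x) x)" using decr by (rule decseq_SucI)
    then have "inner (p (n + n) x) x \<le> inner (p 0 x) x" unfolding decseq_def by blast
    then show ?thesis by (simp add: p_shift[symmetric] p0 norm_eq_sqrt_inner)
  qed
  have conv: "convergent (\<lambda>n. p n x)" for x
  proof -
    obtain L where L: "(\<lambda>n. inner (p n x) x) \<longlonglongrightarrow> L" "\<And>n. L \<le> inner (p n x) x"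
      using decseq_convergent[of "\<lambda>n. inner (p n x) x" 0] decr[of _ x] nonneg[of _ x]
      by (metis decseq_SucI)
    \<comment> \<open>The forms decrease to \<open>L\<close>, and the squared distance of two
      iterates combines three of their values with coefficients 1, 1 and -2.\<close>
    have "Cauchy (\<lambda>n. p n x)"
    proof (rule metric_CauchyI)
      fix e :: real assume "0 < e"
      then have "0 < e\<^sup>2 / 2" by simp
      then obtain M where M: "\<And>n. n \<ge> M \<Longrightarrow> inner (p n x) x < L + e\<^sup>2 / 2"
        using order_tendstoD(2)[OF L(1), of "L + e\<^sup>2 / 2"] unfolding eventually_sequentially by auto
      have "dist (p m x) (p n x) < e" if "m \<ge> M" "n \<ge> M" for m n
      proof -
        have "(norm (p m x - p n x))\<^sup>2 =
            inner (p (m + m) x) x + inner (p (n + n) x) x - 2 * inner (p (m + n) x) x"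
          by (simp add: power2_norm_eq_inner inner_simps p_shift add.commute)
        also have "\<dots> < e\<^sup>2"
          using M[of "m + m"] M[of "n + n"] L(2)[of "m + n"] that by (simp add: field_simps)
        finally show ?thesis
          using \<open>0 < e\<close> by (simp add: dist_norm power2_less_imp_less)
      qed
      then show "\<exists>M. \<forall>m\<ge>M. \<forall>n\<ge>M. dist (p m x) (p n x) < e" by blast
    qed
    then show ?thesis by (simp add: Cauchy_convergent_iff)
  qed
  define q where "q x = lim (\<lambda>n. p n x)" for x
  have q: "(\<lambda>n. p n x) \<longlonglongrightarrow> q x" for x
    using conv unfolding q_def by (simp add: convergent_LIMSEQ_iff)
  have "bounded_linear q"
  proof (rule bounded_linear_intro[where K = 1])
    show "q (x + y) = q x + q y" for x y
      by (rule LIMSEQ_unique[OF q]) (simp add: p_lin tendsto_add q)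
    show "q (c *\<^sub>R x) = c *\<^sub>R q x" for c x
      by (rule LIMSEQ_unique[OF q]) (simp add: p_lin tendsto_scaleR q)
    show "norm (q x) \<le> norm x * 1" for x
      by (rule LIMSEQ_le_const2[OF tendsto_norm[OF q]]) (simp add: norm_p)
  qed
  define P where "P = Blinfun q"
  have P: "blinfun_apply P = q"
    using \<open>bounded_linear q\<close> by (simp add: P_def bounded_linear_Blinfun_apply)
  have fixed: "q x = x" if "N x = 0" for x
  proof -
    have "p n x = x" for n by (induction n) (simp_all add: p0 pSuc A_def blinfun.bilinear_simps that)
    then show ?thesis using q[of x] by (simp add: LIMSEQ_const_iff)
  qed
  have Nq: "N (q x) = 0" for x
  proof -
    have "(\<lambda>n. p (Suc n) x) \<longlonglongrightarrow> q x" using q LIMSEQ_Suc by blast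
    moreover have "(\<lambda>n. p (Suc n) x) \<longlonglongrightarrow> A (q x)" unfolding pSuc by (intro tendsto_intros q)
    \<comment> \<open>The limit is fixed by \<open>A\<close>, and comparing the forms of
      \<open>A\<close> and the identity there leaves
      \<open>r * (norm (N (q x)))\<^sup>2 = 0\<close>.\<close>
    ultimately have "A (q x) = q x" using LIMSEQ_unique by blast
    then have "r * (norm (N (q x)))\<^sup>2 = 0" using A_inner[of "q x"] by (simp add: power2_norm_eq_inner)
    then show ?thesis by (cases "N = 0") (auto simp: r_def)
  qed
  show thesis
  proof
    have "is_adjoint P P \<longleftrightarrow> (\<forall>x y. inner (q x) y = inner x (q y))" by (simp add: is_adjoint_def P)
    also have "\<dots>"
    proof (intro allI)
      fix x y
      have "(\<lambda>n. inner (p n x) y) \<longlonglongrightarrow> inner (q x) y" "(\<lambda>n. inner x (p n y)) \<longlonglongrightarrow> inner x (q y)"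
        by (intro tendsto_intros q)+
      moreover have "inner (p n x) y = inner x (p n y)" for n
        using p_shift[of 0 x n y] by (simp add: p0)
      ultimately show "inner (q x) y = inner x (q y)" using LIMSEQ_unique by auto
    qed
    finally show "is_adjoint P P" .
    show "P o\<^sub>L P = P" by (rule blinfun_eqI) (simp add: P fixed Nq)
    show "N o\<^sub>L P = 0" by (rule blinfun_eqI) (simp add: P Nq)
    show "P o\<^sub>L X = X" if "N o\<^sub>L X = 0" for X :: "'a \<Rightarrow>\<^sub>L 'a"
      using blinfun_compose_eqD[OF that] by (intro blinfun_eqI) (simp add: P fixed)
    show "commuting X P" if X: "commuting X N" for X
    proof (rule commutingI)
      fix x
      have "X (p n x) = p n (X x)" for n
        by (induction n) (simp_all add: p0 pSuc A_def blinfun.bilinear_simps commutingD[OF X])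
      moreover have "(\<lambda>n. X (p n x)) \<longlonglongrightarrow> X (q x)" by (intro tendsto_intros q)
      ultimately show "X (P x) = P (X x)" using LIMSEQ_unique[OF q[of "X x"]] by (simp add: P)
    qed
  qed
qed

text \<open>
  Let \<open>P\<close> be the projection onto the kernel of \<open>R - S\<close>. As \<open>(R - S) (R + S) = 0\<close>, the symmetry \<open>2 P - I\<close>
  is \<open>I\<close> on the range of \<open>R + S\<close> and \<open>- I\<close> on the range of \<open>R - S\<close>.
\<close>

lemma sign_operator:
  fixes R S :: "'a::{real_inner,banach} \<Rightarrow>\<^sub>L 'a"
  assumes "is_adjoint R R" "is_adjoint S S" and comm: "commuting R S" and sq: "R o\<^sub>L R = S o\<^sub>L S"
  obtains Q where "is_adjoint Q Q" "Q o\<^sub>L Q = id_blinfun" "Q o\<^sub>L R = S"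
    "\<And>X. commuting X R \<Longrightarrow> commuting X S \<Longrightarrow> commuting X Q"
proof -
  have symm: "is_adjoint (R - S) (R - S)" by (intro is_adjoint_intros assms)
  show thesis
  proof (rule kernel_projection[OF symm])
    fix P :: "'a \<Rightarrow>\<^sub>L 'a"
    assume P: "is_adjoint P P" "P o\<^sub>L P = P" "(R - S) o\<^sub>L P = 0"
      "\<And>X. commuting X (R - S) \<Longrightarrow> commuting X P"
      "\<And>X :: 'a \<Rightarrow>\<^sub>L 'a. (R - S) o\<^sub>L X = 0 \<Longrightarrow> P o\<^sub>L X = X"
    have "(R - S) o\<^sub>L (R + S) = 0"
      by (rule blinfun_eqI) (simp add: blinfun.bilinear_simps commutingD[OF comm] blinfun_compose_eqD[OF sq])
    then have plus: "P (R x) + P (S x) = R x + S x" for x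
      using blinfun_compose_eqD[OF P(5), of "R + S" x] by (simp add: blinfun.bilinear_simps)
    have "commuting (R - S) P" by (rule P(4)) (rule refl)
    then have minus: "P (R x) = P (S x)" for x
      using commutingD[OF \<open>commuting (R - S) P\<close>, of x] blinfun_compose_eqD[OF P(3), of x]
      by (simp add: blinfun.bilinear_simps)
    show thesis
    proof (rule that[of "2 *\<^sub>R P - id_blinfun"])
      show "is_adjoint (2 *\<^sub>R P - id_blinfun) (2 *\<^sub>R P - id_blinfun)" by (intro is_adjoint_intros P)
      show "(2 *\<^sub>R P - id_blinfun) o\<^sub>L (2 *\<^sub>R P - id_blinfun) = id_blinfun"
        by (rule blinfun_eqI) (simp add: blinfun.bilinear_simps blinfun_compose_eqD[OF P(2)] algebra_simps
            flip: scaleR_2)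
      \<comment> \<open>\<open>2 P R = P R + P S = R + S\<close> by \<open>minus\<close> and
        \<open>plus\<close>; subtracting \<open>R\<close> leaves \<open>S\<close>.\<close>
      show "(2 *\<^sub>R P - id_blinfun) o\<^sub>L R = S"
        using plus minus by (intro blinfun_eqI) (simp add: blinfun.bilinear_simps scaleR_2)
      show "commuting X (2 *\<^sub>R P - id_blinfun)" if "commuting X R" "commuting X S" for X
      proof -
        have "commuting X (R - S)"
          by (rule commutingI) (simp add: blinfun.bilinear_simps commutingD[OF that(1)] commutingD[OF that(2)])
        then have "commuting X P" by (rule P(4))
        then show ?thesis by (intro commutingI) (simp add: blinfun.bilinear_simps commutingD)
      qed
    qed
  qed
qed

section \<open>Curves in the unit sphere\<close>

lemma velocity_works:
  "\<gamma> differentiable_on {a..b} \<Longrightarrow> t \<in> {a..b} \<Longrightarrow>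
    (\<gamma> has_vector_derivative velocity a b \<gamma> t) (at t within {a..b})"
  by (simp add: velocity_def differentiable_on_def vector_derivative_works)

lemma velocity_eqI:
  "(\<gamma> has_vector_derivative v) (at t within {a..b}) \<Longrightarrow> a < b \<Longrightarrow> t \<in> {a..b} \<Longrightarrow> velocity a b \<gamma> t = v"
  unfolding velocity_def using vector_derivative_within_cbox[of a b t \<gamma> v] by simp

text \<open>Serves to differentiate identities that are known only on an interval; nondegeneracy
  makes the derivative unique also at the end points.\<close>

lemma vector_derivative_unique_Icc:
  assumes "(f has_vector_derivative f') (at t within {a..b})" "(g has_vector_derivative g') (at t within {a..b})"
    and "\<And>s. s \<in> {a..b} \<Longrightarrow> f s = g s" and "t \<in> {a..b}" "a < b"
  shows "f' = g'"
proof -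
  have "(f has_vector_derivative g') (at t within {a..b})"
    using assms by (intro has_vector_derivative_transform[where f = g and g = f]) auto
  then show ?thesis using velocity_eqI assms by metis
qed

lemma constant_inner_derivative:
  fixes x :: "real \<Rightarrow> 'a::real_inner"
  assumes "a < b" "t \<in> {a..b}" "(x has_vector_derivative v) (at t within {a..b})"
    and "\<And>t. t \<in> {a..b} \<Longrightarrow> norm (x t) = 1"
  shows "inner (x t) v = 0"
proof -
  have "((\<lambda>t. inner (x t) (x t)) has_vector_derivative inner (x t) v + inner v (x t)) (at t within {a..b})"
    by (intro bounded_bilinear.has_vector_derivative[OF bounded_bilinear_inner] assms)
  from vector_derivative_unique_Icc[OF this has_vector_derivative_const _ assms(2,1)]
  have "inner (x t) v + inner v (x t) = 0"
    using assms(4) by (simp add: norm_eq_sqrt_inner)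
  then show ?thesis by (simp add: inner_commute)
qed

text \<open>The factor \<open>r < 1\<close> keeps the argument away from \<open>1\<close> and \<open>-1\<close>, where \<open>arccos\<close> is not differentiable.\<close>

lemma spherical_speed_bound:
  fixes x :: "real \<Rightarrow> 'a::real_inner"
  assumes ab: "a < b" and x: "\<And>t. t \<in> {a..b} \<Longrightarrow> (x has_vector_derivative x' t) (at t within {a..b})"
    and unit: "\<And>t. t \<in> {a..b} \<Longrightarrow> norm (x t) = 1" "norm p = 1"
    and r: "0 \<le> r" "r < 1"
    and g: "(g has_integral I) {a..b}" "\<And>t. t \<in> {a..b} \<Longrightarrow> norm (x' t) \<le> g t"
  shows "arccos (r * inner p (x b)) - arccos (r * inner p (x a)) \<le> I"
proof -
  define \<phi> where "\<phi> t = inner p (x t)" for t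
  define F' where "F' t = inverse (- sqrt (1 - (r * \<phi> t)\<^sup>2)) * (r * inner p (x' t))" for t
  have \<phi>1: "\<bar>\<phi> t\<bar> \<le> 1" if "t \<in> {a..b}" for t
    using Cauchy_Schwarz_ineq2[of p "x t"] unit(2) unit(1)[OF that] by (simp add: \<phi>_def)
  have small: "\<bar>r * \<phi> t\<bar> < 1" if "t \<in> {a..b}" for t
  proof -
    have "\<bar>r * \<phi> t\<bar> \<le> r * 1" using \<phi>1[OF that] r by (simp add: abs_mult mult_left_le)
    then show ?thesis using r by linarith
  qed
  have "((\<lambda>t. arccos (r * \<phi> t)) has_vector_derivative F' t) (at t within {a..b})" if t: "t \<in> {a..b}" for t
  proof -
    have "(\<phi> has_vector_derivative inner p (x' t)) (at t within {a..b})"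
      unfolding \<phi>_def
      using bounded_linear.has_vector_derivative[OF bounded_linear_inner_right x[OF t]] .
    then have "((\<lambda>t. r * \<phi> t) has_real_derivative r * inner p (x' t)) (at t within {a..b})"
      unfolding has_real_derivative_iff_has_vector_derivative[symmetric] by (rule DERIV_cmult)
    moreover have "DERIV arccos (r * \<phi> t) :> inverse (- sqrt (1 - (r * \<phi> t)\<^sup>2))"
      using small[OF t] by (intro DERIV_arccos) auto
    ultimately show ?thesis
      unfolding F'_def has_real_derivative_iff_has_vector_derivative[symmetric] by (rule DERIV_chain2[rotated])
  qed
  then have "(F' has_integral arccos (r * \<phi> b) - arccos (r * \<phi> a)) {a..b}"
    using ab by (intro fundamental_theorem_of_calculus) auto
  moreover have "F' t \<le> g t" if t: "t \<in> {a..b}" for t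
  proof -
    have orth: "inner (x t) (x' t) = 0" by (rule constant_inner_derivative[OF ab t x[OF t] unit(1)])
    have xx: "inner (x t) (x t) = 1" "inner p p = 1"
      using unit(1)[OF t] unit(2) by (simp_all add: norm_eq_sqrt_inner)
    \<comment> \<open>The velocity is orthogonal to \<open>x t\<close>, so only the tangential part
      of \<open>p\<close> counts; its norm is \<open>sqrt (1 - (\<phi> t)\<^sup>2)\<close>.\<close>
    have "inner p (x' t) = inner (p - \<phi> t *\<^sub>R x t) (x' t)"
      by (simp add: inner_simps orth)
    then have "\<bar>inner p (x' t)\<bar> \<le> norm (p - \<phi> t *\<^sub>R x t) * norm (x' t)"
      by (simp add: Cauchy_Schwarz_ineq2)
    also have "norm (p - \<phi> t *\<^sub>R x t) = sqrt (1 - (\<phi> t)\<^sup>2)"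
      unfolding norm_eq_sqrt_inner
      by (simp add: inner_simps xx \<phi>_def inner_commute power2_eq_square)
    finally have "r * \<bar>inner p (x' t)\<bar> \<le> (r * sqrt (1 - (\<phi> t)\<^sup>2)) * norm (x' t)"
      using r by (simp add: mult_left_mono mult.assoc)
    \<comment> \<open>Pulling \<open>r\<close> under the root and then enlarging
      \<open>r\<^sup>2\<close> to 1 produces the denominator in the derivative of
      \<open>arccos\<close>.\<close>
    also have "r * sqrt (1 - (\<phi> t)\<^sup>2) = sqrt (r\<^sup>2 - (r * \<phi> t)\<^sup>2)"
      using r real_sqrt_mult[of "r\<^sup>2" "1 - (\<phi> t)\<^sup>2"] by (simp add: right_diff_distrib power_mult_distrib)
    also have "sqrt (r\<^sup>2 - (r * \<phi> t)\<^sup>2) * norm (x' t) \<le> sqrt (1 - (r * \<phi> t)\<^sup>2) * norm (x' t)"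
      using r by (intro mult_right_mono real_sqrt_le_mono) (auto simp: power_le_one)
    finally have "r * \<bar>inner p (x' t)\<bar> \<le> sqrt (1 - (r * \<phi> t)\<^sup>2) * norm (x' t)" .
    moreover have "0 < sqrt (1 - (r * \<phi> t)\<^sup>2)"
      using small[OF t] by (simp add: abs_square_less_1)
    ultimately have "\<bar>F' t\<bar> \<le> norm (x' t)"
      using r by (simp add: F'_def abs_mult field_simps)
    then show ?thesis using g(2)[OF t] by linarith
  qed
  ultimately show ?thesis
    unfolding \<phi>_def[symmetric] using has_integral_le[OF _ g(1)] by blast
qed

text \<open>Evaluation at a unit vector does not increase speed, so the spherical bound applies on
  each smooth piece. The bounds telescope, and \<open>r\<close> tends to 1 at the end.\<close>

lemma angle_le_curve_length:
  fixes \<gamma> :: "real \<Rightarrow> ('a::real_inner \<Rightarrow>\<^sub>L 'a)"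
  assumes ab: "a < b" and \<gamma>: "piecewise_C1_on a b \<gamma>"
    and unit: "\<And>t. t \<in> {a..b} \<Longrightarrow> norm (\<gamma> t x) = 1" and "norm x = 1"
  shows "arccos (inner (\<gamma> a x) (\<gamma> b x)) \<le> curve_length a b \<gamma>"
proof -
  define \<phi> where "\<phi> t = inner (\<gamma> a x) (\<gamma> t x)" for t
  obtain n s where s: "s 0 = a" "s n = b"
    "\<And>i. i < (n::nat) \<Longrightarrow> s i < s (Suc i)" "\<And>i. i < n \<Longrightarrow> C1_on (s i) (s (Suc i)) \<gamma>"
    using \<gamma> unfolding piecewise_C1_on_def by blast
  have mono: "s i \<le> s j" if "i \<le> j" "j \<le> n" for i j
    using that
  proof (induction j)
    case (Suc j)
    then show ?case using s(3)[of j] by (cases "i = Suc j") auto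
  qed simp
  \<comment> \<open>\<open>I\<close> is chosen before \<open>r\<close>, so that the limit in
    \<open>r\<close> can be taken afterwards.\<close>
  have partial: "\<exists>I. ((\<lambda>t. norm (velocity a b \<gamma> t)) has_integral I) {a..s k} \<and>
      (\<forall>r. 0 \<le> r \<and> r < 1 \<longrightarrow> arccos (r * \<phi> (s k)) - arccos (r * \<phi> a) \<le> I)" if "k \<le> n" for k
    using that
  proof (induction k)
    case 0
    then show ?case by (auto simp: s(1) intro!: exI[of _ 0] has_integral_refl)
  next
    case (Suc k)
    let ?a = "s k" and ?b = "s (Suc k)"
    have k: "?a < ?b" "a \<le> ?a" "?b \<le> b"
      using s(1,2) s(3)[of k] mono[of 0 k] mono[of "Suc k" n] Suc.prems by auto
    have C1: "\<gamma> differentiable_on {?a..?b}" "continuous_on {?a..?b} (velocity ?a ?b \<gamma>)"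
      using s(4)[of k] Suc.prems by (auto simp: C1_on_def)
    obtain I where I: "((\<lambda>t. norm (velocity a b \<gamma> t)) has_integral I) {a..?a}"
      "\<And>r. 0 \<le> r \<Longrightarrow> r < 1 \<Longrightarrow> arccos (r * \<phi> ?a) - arccos (r * \<phi> a) \<le> I"
      using Suc.IH Suc.prems by auto
    define I' where "I' = integral {?a..?b} (\<lambda>t. norm (velocity ?a ?b \<gamma> t))"
    have I': "((\<lambda>t. norm (velocity ?a ?b \<gamma> t)) has_integral I') {?a..?b}"
      unfolding I'_def by (intro integrable_integral integrable_continuous_interval continuous_intros C1)
    \<comment> \<open>At the break points the velocity within the piece may differ from that within
      the whole interval; two points do not affect the integral.\<close>
    have "((\<lambda>t. norm (velocity a b \<gamma> t)) has_integral I') {?a..?b}"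
    proof (rule has_integral_spike_finite[OF _ _ I'])
      show "finite {?a, ?b}" by simp
      fix t assume "t \<in> {?a..?b} - {?a, ?b}"
      then have "t \<in> interior {?a..?b}" "t \<in> interior {a..b}" using k by auto
      then show "norm (velocity a b \<gamma> t) = norm (velocity ?a ?b \<gamma> t)"
        unfolding velocity_def by (simp only: at_within_interior)
    qed
    from has_integral_combine[OF k(2) less_imp_le[OF k(1)] I(1) this]
    have "((\<lambda>t. norm (velocity a b \<gamma> t)) has_integral I + I') {a..?b}" .
    moreover have "arccos (r * \<phi> ?b) - arccos (r * \<phi> a) \<le> I + I'" if r: "0 \<le> r" "r < 1" for r
    proof -
      have "arccos (r * \<phi> ?b) - arccos (r * \<phi> ?a) \<le> I'"
        unfolding \<phi>_def
      proof (rule spherical_speed_bound[OF k(1) _ _ _ r I', where x = "\<lambda>t. blinfun_apply (\<gamma> t) x"])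
        show "((\<lambda>t. \<gamma> t x) has_vector_derivative velocity ?a ?b \<gamma> t x) (at t within {?a..?b})"
          if "t \<in> {?a..?b}" for t
          using bounded_linear.has_vector_derivative[OF blinfun.bounded_linear_left velocity_works[OF C1(1) that]] .
        show "norm (velocity ?a ?b \<gamma> t x) \<le> norm (velocity ?a ?b \<gamma> t)" for t
          using norm_blinfun[of "velocity ?a ?b \<gamma> t" x] \<open>norm x = 1\<close> by simp
      qed (use unit k ab in auto)
      then show ?thesis using I(2)[OF r] by linarith
    qed
    ultimately show ?case by blast
  qed
  obtain I where I: "((\<lambda>t. norm (velocity a b \<gamma> t)) has_integral I) {a..b}"
    "\<And>r. 0 \<le> r \<Longrightarrow> r < 1 \<Longrightarrow> arccos (r * \<phi> b) - arccos (r * \<phi> a) \<le> I"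
    using partial[of n] s(2) by auto
  have \<phi>1: "\<phi> a = 1" "\<bar>\<phi> b\<bar> \<le> 1"
    using unit[of a] unit[of b] ab Cauchy_Schwarz_ineq2[of "\<gamma> a x" "\<gamma> b x"]
    by (auto simp: \<phi>_def norm_eq_sqrt_inner)
  define r where "r n = 1 - 1 / (real n + 1)" for n
  have "r \<longlonglongrightarrow> 1 - 0"
    unfolding r_def using LIMSEQ_inverse_real_of_nat
    by (intro tendsto_intros) (simp add: inverse_eq_divide add.commute)
  then have r: "r \<longlonglongrightarrow> 1" by simp
  have r01: "0 \<le> r n" "r n < 1" for n by (auto simp: r_def)
  have lim: "(\<lambda>n. arccos (r n * c)) \<longlonglongrightarrow> arccos c" if "\<bar>c\<bar> \<le> 1" for c
  proof (rule continuous_on_tendsto_compose[OF continuous_on_arccos'])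
    show "(\<lambda>n. r n * c) \<longlonglongrightarrow> c" using tendsto_mult_right[OF r, of c] by simp
    have "\<bar>r n * c\<bar> \<le> 1" for n
      using r01[of n] that by (simp add: abs_mult mult_le_one)
    then show "\<forall>\<^sub>F n in sequentially. r n * c \<in> {-1..1}"
      by (auto simp: abs_le_iff)
  qed (use that in auto)
  have "(\<lambda>n. arccos (r n * \<phi> b) - arccos (r n * \<phi> a)) \<longlonglongrightarrow> arccos (\<phi> b) - arccos (\<phi> a)"
    using \<phi>1 by (intro tendsto_diff lim) auto
  from LIMSEQ_le_const2[OF this, of I] have "arccos (\<phi> b) - arccos (\<phi> a) \<le> I"
    using I(2)[OF r01] by blast
  then show ?thesis
    using I(1) \<phi>1 by (simp add: curve_length_def integral_unique \<phi>_def)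
qed

text \<open>
  A Wirtinger inequality. The difference \<open>D t = x t - x (1 - t)\<close> vanishes at \<open>0\<close> and \<open>1/2\<close> and
  satisfies \<open>D'' = Y\<^sup>2 D\<close>. For \<open>\<parallel>Y\<parallel> < K < 2\<pi>\<close> the function \<open>K tan (K (t - 1/4))\<close> is a regular solution
  of the Riccati equation on \<open>[0, 1/2]\<close>, and completing the square shows that
  \<open>\<langle>D', D\<rangle> + K tan (K (t - 1/4)) \<parallel>D\<parallel>\<^sup>2\<close> is monotone.
\<close>

lemma periodic_flow_trivial:
  fixes Y :: "'a::real_inner \<Rightarrow>\<^sub>L 'a" and x :: "real \<Rightarrow> 'a"
  assumes x: "\<And>t. t \<in> {0..1} \<Longrightarrow> (x has_vector_derivative Y (x t)) (at t within {0..1})"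
    and closed: "x 0 = x 1" and skew: "is_adjoint Y (- Y)" and small: "norm Y < 2 * pi"
  shows "Y (x 0) = 0"
proof -
  obtain K where K: "norm Y < K" "K < 2 * pi" using dense[OF small] by blast
  have "0 < K" using K(1) norm_ge_zero[of Y] by linarith
  define D where "D t = x t - x (1 - t)" for t
  \<comment> \<open>Time reversal changes the sign of the field, so that \<open>D' = Y E\<close> and
    \<open>E' = Y D\<close>.\<close>
  define E where "E t = x t + x (1 - t)" for t
  have rev: "((\<lambda>t. x (1 - t)) has_vector_derivative - Y (x (1 - t))) (at t within {0..1})"
    if t: "t \<in> {0..1}" for t
  proof -
    have im: "(\<lambda>t. 1 - t) ` {0..1} = {0..1::real}"
      by (auto simp: image_iff intro!: bexI[of _ "1 - _"])
    have "((\<lambda>t. 1 - t) has_vector_derivative - 1) (at t within {0..1::real})"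
      by (auto intro!: derivative_eq_intros)
    moreover have "(x has_vector_derivative Y (x (1 - t))) (at (1 - t) within (\<lambda>t. 1 - t) ` {0..1})"
      unfolding im using t by (intro x) auto
    ultimately show ?thesis
      using vector_diff_chain_within by (fastforce simp: o_def)
  qed
  have dD: "(D has_vector_derivative Y (E t)) (at t within {0..1/2})" if "t \<in> {0..1/2}" for t
  proof -
    have t: "t \<in> {0..1}" using that by auto
    show ?thesis
      using has_vector_derivative_within_subset[OF has_vector_derivative_diff[OF x[OF t] rev[OF t]], of "{0..1/2}"]
      by (simp add: D_def[abs_def] E_def[abs_def] blinfun.bilinear_simps)
  qed
  have dE: "(E has_vector_derivative Y (D t)) (at t within {0..1/2})" if "t \<in> {0..1/2}" for t
  proof -
    have t: "t \<in> {0..1}" using that by auto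
    show ?thesis
      using has_vector_derivative_within_subset[OF has_vector_derivative_add[OF x[OF t] rev[OF t]], of "{0..1/2}"]
      by (simp add: D_def[abs_def] E_def[abs_def] blinfun.bilinear_simps)
  qed
  define q where "q t = K * tan (K * (t - 1/4))" for t
  define W where "W t = inner (Y (E t)) (D t) + q t * inner (D t) (D t)" for t
  \<comment> \<open>The derivative of \<open>W\<close>: a completed square plus the gap in
    \<open>norm (Y (D t)) \<le> K * norm (D t)\<close>, both squared.\<close>
  define W' where "W' t = (norm (Y (E t) + q t *\<^sub>R D t))\<^sup>2 + (K\<^sup>2 * (norm (D t))\<^sup>2 - (norm (Y (D t)))\<^sup>2)" for t
  have skew': "inner (Y u) v = - inner u (Y v)" for u v
    using skew by (simp add: is_adjoint_def blinfun.bilinear_simps)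
  have dW: "(W has_vector_derivative W' t) (at t within {0..1/2})" if t: "t \<in> {0..1/2}" for t
  proof -
    \<comment> \<open>Here \<open>K < 2 * pi\<close> enters: at distance at most 1/4 from the centre
      the argument stays between the poles of \<open>tan\<close>.\<close>
    have "\<bar>K * (t - 1/4)\<bar> < pi / 2"
    proof -
      have "\<bar>t - 1/4\<bar> \<le> 1/4" using t unfolding atLeastAtMost_iff abs_le_iff by linarith
      then have "\<bar>K * (t - 1/4)\<bar> \<le> K * (1/4)"
        using \<open>0 < K\<close> unfolding abs_mult by (intro mult_mono) auto
      then show ?thesis using K by linarith
    qed
    then have cos: "cos (K * (t - 1/4)) \<noteq> 0"
      using cos_gt_zero_pi[of "K * (t - 1/4)"] unfolding abs_less_iff by force
    have "((\<lambda>t. tan (K * (t - 1/4))) has_real_derivative inverse ((cos (K * (t - 1/4)))\<^sup>2) * K) (at t within {0..1/2})"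
      by (rule DERIV_chain2[where f = tan and g = "\<lambda>t. K * (t - 1/4)", OF DERIV_tan[OF cos]])
        (auto intro!: derivative_eq_intros)
    moreover have "inverse ((cos (K * (t - 1/4)))\<^sup>2) = 1 + (tan (K * (t - 1/4)))\<^sup>2"
      using tan_sec[OF cos] by (simp add: power_inverse)
    ultimately have "(q has_real_derivative K * ((1 + (tan (K * (t - 1/4)))\<^sup>2) * K)) (at t within {0..1/2})"
      unfolding q_def by (intro DERIV_cmult) (simp only:)
    moreover have "K * ((1 + (tan (K * (t - 1/4)))\<^sup>2) * K) = K\<^sup>2 + (q t)\<^sup>2"
      by (simp add: q_def power_mult_distrib distrib_left distrib_right power2_eq_square mult_ac)
    ultimately have dq: "(q has_real_derivative K\<^sup>2 + (q t)\<^sup>2) (at t within {0..1/2})"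
      by (simp only:)
    have dYE: "((\<lambda>t. Y (E t)) has_vector_derivative Y (Y (D t))) (at t within {0..1/2})"
      using bounded_linear.has_vector_derivative[OF blinfun.bounded_linear_right dE[OF t]] .
    have "(W has_vector_derivative
        (inner (Y (E t)) (Y (E t)) + inner (Y (Y (D t))) (D t)) +
        (q t * (inner (D t) (Y (E t)) + inner (Y (E t)) (D t)) + (K\<^sup>2 + (q t)\<^sup>2) * inner (D t) (D t)))
        (at t within {0..1/2})"
      unfolding W_def
      by (intro has_vector_derivative_add has_vector_derivative_mult
          bounded_bilinear.has_vector_derivative[OF bounded_bilinear_inner] dYE dD[OF t]
          dq[unfolded has_real_derivative_iff_has_vector_derivative])
    moreover have "(inner (Y (E t)) (Y (E t)) + inner (Y (Y (D t))) (D t)) +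
        (q t * (inner (D t) (Y (E t)) + inner (Y (E t)) (D t)) + (K\<^sup>2 + (q t)\<^sup>2) * inner (D t) (D t)) = W' t"
      unfolding W'_def power2_norm_eq_inner skew'[of "Y (D t)"]
      by (simp add: inner_simps algebra_simps power2_eq_square inner_commute)
    ultimately show ?thesis by simp
  qed
  have defect: "0 \<le> K\<^sup>2 * (norm (D t))\<^sup>2 - (norm (Y (D t)))\<^sup>2" "K\<^sup>2 * (norm (D t))\<^sup>2 - (norm (Y (D t)))\<^sup>2 = 0 \<Longrightarrow> D t = 0" for t
  proof -
    have "(norm (Y (D t)))\<^sup>2 \<le> (norm Y)\<^sup>2 * (norm (D t))\<^sup>2"
      unfolding power_mult_distrib[symmetric] by (intro power_mono norm_blinfun) simp
    moreover have "(norm Y)\<^sup>2 < K\<^sup>2" using K(1) by (intro power_strict_mono) auto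
    moreover have "(norm Y)\<^sup>2 * (norm (D t))\<^sup>2 \<le> K\<^sup>2 * (norm (D t))\<^sup>2"
      using \<open>(norm Y)\<^sup>2 < K\<^sup>2\<close> by (intro mult_right_mono) auto
    moreover have "(norm Y)\<^sup>2 * (norm (D t))\<^sup>2 < K\<^sup>2 * (norm (D t))\<^sup>2" if "D t \<noteq> 0"
      using \<open>(norm Y)\<^sup>2 < K\<^sup>2\<close> that by (intro mult_strict_right_mono) auto
    ultimately show "0 \<le> K\<^sup>2 * (norm (D t))\<^sup>2 - (norm (Y (D t)))\<^sup>2"
      "K\<^sup>2 * (norm (D t))\<^sup>2 - (norm (Y (D t)))\<^sup>2 = 0 \<Longrightarrow> D t = 0" by force+
  qed
  have W'_nonneg: "0 \<le> W' t" for t using defect(1)[of t] by (simp add: W'_def)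
  have mono: "W s \<le> W t" if "0 \<le> s" "s \<le> t" "t \<le> 1/2" for s t
  proof -
    have "(W' has_integral W t - W s) {s..t}"
    proof (rule fundamental_theorem_of_calculus[OF that(2)])
      fix u assume "u \<in> {s..t}"
      then show "(W has_vector_derivative W' u) (at u within {s..t})"
        using that by (intro has_vector_derivative_within_subset[OF dW]) auto
    qed
    then have "0 \<le> W t - W s" by (rule has_integral_nonneg) (rule W'_nonneg)
    then show ?thesis by simp
  qed
  have D0: "D 0 = 0" "D (1/2) = 0" using closed by (simp_all add: D_def)
  then have "W 0 = 0" "W (1/2) = 0" by (simp_all add: W_def)
  \<comment> \<open>\<open>W\<close> is monotone and vanishes at both ends, so it is 0 throughout
    and both parts of its derivative vanish.\<close>
  then have W0: "W t = 0" if "t \<in> {0..1/2}" for t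
    using mono[of 0 t] mono[of t "1/2"] that by auto
  have "D t = 0" if "t \<in> {0..1/2}" for t
  proof (rule defect(2))
    have "W' t = 0" using vector_derivative_unique_Icc[OF dW[OF that] has_vector_derivative_const W0 that] by simp
    then show "K\<^sup>2 * (norm (D t))\<^sup>2 - (norm (Y (D t)))\<^sup>2 = 0"
      using defect(1)[of t] unfolding W'_def by (smt (verit) zero_le_power2)
  qed
  \<comment> \<open>\<open>D\<close> vanishes on [0, 1/2], hence so does its derivative
    \<open>Y (E 0)\<close> at 0, and \<open>E 0 = 2 x 0\<close>.\<close>
  from vector_derivative_unique_Icc[OF dD has_vector_derivative_const this, of 0] have "Y (E 0) = 0" by simp
  then show ?thesis
    using closed by (simp add: E_def blinfun.bilinear_simps flip: scaleR_2)
qed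

section \<open>Geodesics between two Lagrangian subspaces\<close>

locale lagrangian_pair =
  fixes J \<epsilon>\<^sub>0 \<epsilon>\<^sub>1 :: "'a::{real_inner,banach} \<Rightarrow>\<^sub>L 'a"
  assumes J: "complex_structure J"
    and \<epsilon>\<^sub>0: "\<epsilon>\<^sub>0 \<in> lagrangian_grassmannian J"
    and \<epsilon>\<^sub>1: "\<epsilon>\<^sub>1 \<in> lagrangian_grassmannian J"
begin

lemma J_J: "J (J x) = - x"
proof -
  have "J o\<^sub>L J = - id_blinfun" using J by (simp add: complex_structure_def)
  from blinfun_compose_eqD[OF this] show ?thesis by (simp add: blinfun.bilinear_simps)
qed

lemma J_adjoint: "is_adjoint J (- J)"
  using J by (simp add: complex_structure_def)

lemma lagrangian_simps:
  assumes "\<epsilon> \<in> lagrangian_grassmannian J"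
  shows "is_adjoint \<epsilon> \<epsilon>" "\<epsilon> (\<epsilon> x) = x" "\<epsilon> (J x) = - J (\<epsilon> x)" "norm (\<epsilon> x) = norm x"
proof -
  have e: "is_adjoint \<epsilon> \<epsilon>" "\<epsilon> o\<^sub>L \<epsilon> = id_blinfun" "\<epsilon> o\<^sub>L J = - (J o\<^sub>L \<epsilon>)"
    using assms by (auto simp: lagrangian_grassmannian_def)
  show "is_adjoint \<epsilon> \<epsilon>" "norm (\<epsilon> x) = norm x" using e norm_isometry by auto
  show "\<epsilon> (\<epsilon> x) = x" "\<epsilon> (J x) = - J (\<epsilon> x)"
    using blinfun_compose_eqD[OF e(2)] blinfun_compose_eqD[OF e(3)] by (simp_all add: blinfun.bilinear_simps)
qed

lemmas endpoint_simps = J_J lagrangian_simps[OF \<epsilon>\<^sub>0] lagrangian_simps[OF \<epsilon>\<^sub>1]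

text \<open>
  With \<open>J\<close> as imaginary unit, \<open>\<epsilon>\<^sub>1 \<epsilon>\<^sub>0\<close> is unitary and \<open>C + J S\<close> is its decomposition into real and
  imaginary part.
\<close>

definition C :: "'a \<Rightarrow>\<^sub>L 'a" where
  "C = (1/2) *\<^sub>R ((\<epsilon>\<^sub>1 o\<^sub>L \<epsilon>\<^sub>0) + (\<epsilon>\<^sub>0 o\<^sub>L \<epsilon>\<^sub>1))"

definition S :: "'a \<Rightarrow>\<^sub>L 'a" where
  "S = (- 1/2) *\<^sub>R (J o\<^sub>L ((\<epsilon>\<^sub>1 o\<^sub>L \<epsilon>\<^sub>0) - (\<epsilon>\<^sub>0 o\<^sub>L \<epsilon>\<^sub>1)))"

text \<open>As \<open>I - C\<close> is symmetric and nonnegative, this is the least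
  \<open>K \<ge> 0\<close> with \<open>inner (x - C x) x \<le> K * (norm x)\<^sup>2\<close> for all
  \<open>x\<close>.\<close>

definition \<kappa> :: real where
  "\<kappa> = norm (id_blinfun - C)"

text \<open>Rescales \<open>I - C\<close> to the range that the functional calculus asks for; for
  \<open>\<kappa> = 0\<close> the quotient is 0 and \<open>T = 0\<close>.\<close>

definition T :: "'a \<Rightarrow>\<^sub>L 'a" where
  "T = (1 / \<kappa>) *\<^sub>R (id_blinfun - C)"

lemma C_symmetric: "is_adjoint C C"
proof -
  have "is_adjoint C ((1/2) *\<^sub>R ((\<epsilon>\<^sub>0 o\<^sub>L \<epsilon>\<^sub>1) + (\<epsilon>\<^sub>1 o\<^sub>L \<epsilon>\<^sub>0)))"
    unfolding C_def by (intro is_adjoint_intros endpoint_simps)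
  then show ?thesis by (simp add: C_def add.commute)
qed

lemma C_eq: "C = id_blinfun - \<kappa> *\<^sub>R T"
  by (cases "\<kappa> = 0") (auto simp: T_def \<kappa>_def)

lemma difference_square: "(\<epsilon>\<^sub>0 - \<epsilon>\<^sub>1) o\<^sub>L (\<epsilon>\<^sub>0 - \<epsilon>\<^sub>1) = 2 *\<^sub>R (id_blinfun - C)"
  by (rule blinfun_eqI)
    (simp add: C_def blinfun.bilinear_simps endpoint_simps algebra_simps flip: scaleR_2)

lemma \<kappa>_le: "2 * \<kappa> \<le> (norm (\<epsilon>\<^sub>0 - \<epsilon>\<^sub>1))\<^sup>2"
proof -
  have "2 * \<kappa> = norm ((\<epsilon>\<^sub>0 - \<epsilon>\<^sub>1) o\<^sub>L (\<epsilon>\<^sub>0 - \<epsilon>\<^sub>1))"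
    by (simp add: difference_square \<kappa>_def)
  also have "\<dots> \<le> (norm (\<epsilon>\<^sub>0 - \<epsilon>\<^sub>1))\<^sup>2"
    unfolding power2_eq_square by (rule norm_blinfun_compose)
  finally show ?thesis .
qed

lemma \<kappa>_bounds: "0 \<le> \<kappa>" "\<kappa> \<le> 2"
proof -
  have "norm (\<epsilon>\<^sub>0 - \<epsilon>\<^sub>1) \<le> 2"
  proof (rule norm_blinfun_bound)
    show "norm ((\<epsilon>\<^sub>0 - \<epsilon>\<^sub>1) x) \<le> 2 * norm x" for x
      using norm_triangle_ineq4[of "\<epsilon>\<^sub>0 x" "\<epsilon>\<^sub>1 x"] by (simp add: blinfun.bilinear_simps endpoint_simps)
  qed simp
  then have "(norm (\<epsilon>\<^sub>0 - \<epsilon>\<^sub>1))\<^sup>2 \<le> 2\<^sup>2" by (intro power_mono) auto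
  then show "\<kappa> \<le> 2" using \<kappa>_le by simp
  show "0 \<le> \<kappa>" by (simp add: \<kappa>_def)
qed

lemma defect_inner: "inner (x - C x) x = (norm (\<epsilon>\<^sub>0 x - \<epsilon>\<^sub>1 x))\<^sup>2 / 2"
proof -
  have "is_adjoint (\<epsilon>\<^sub>0 - \<epsilon>\<^sub>1) (\<epsilon>\<^sub>0 - \<epsilon>\<^sub>1)" by (intro is_adjoint_intros endpoint_simps)
  from symmetric_square_inner[OF this, of x x]
  have "inner ((2 *\<^sub>R (id_blinfun - C)) x) x = inner ((\<epsilon>\<^sub>0 - \<epsilon>\<^sub>1) x) ((\<epsilon>\<^sub>0 - \<epsilon>\<^sub>1) x)"
    unfolding blinfun_compose_eqD[OF difference_square] .
  then show ?thesis
    by (simp add: minus_blinfun.rep_eq scaleR_blinfun.rep_eq power2_norm_eq_inner)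
qed

sublocale positive_contraction T
proof
  show "is_adjoint T T"
    unfolding T_def by (intro is_adjoint_intros C_symmetric)
  have eq: "inner (T x) x = inner (x - C x) x / \<kappa>" for x
    by (simp add: T_def blinfun.bilinear_simps)
  show "0 \<le> inner (T x) x" for x
    using \<kappa>_bounds by (simp add: eq defect_inner)
  show "inner (T x) x \<le> (norm x)\<^sup>2" for x
  proof (cases "\<kappa> = 0")
    case False
    have "inner (x - C x) x \<le> norm ((id_blinfun - C) x) * norm x"
      using norm_cauchy_schwarz[of "x - C x" x] by (simp add: blinfun.bilinear_simps)
    also have "\<dots> \<le> (\<kappa> * norm x) * norm x"
      unfolding \<kappa>_def by (intro mult_right_mono norm_blinfun) simp
    finally show ?thesis
      using False \<kappa>_bounds by (simp add: eq field_simps power2_eq_square)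
  qed (simp add: eq)
qed

section \<open>A one-parameter group of rotations from \<open>\<epsilon>\<^sub>0\<close> to
  \<open>\<epsilon>\<^sub>1\<close>\<close>

definition angle :: "real \<Rightarrow> real" where
  "angle x = arccos (1 - \<kappa> * x)"

lemma angle_arg: "x \<in> {0..1} \<Longrightarrow> 1 - \<kappa> \<le> 1 - \<kappa> * x \<and> 1 - \<kappa> * x \<le> 1 \<and> - 1 \<le> 1 - \<kappa> * x"
  using \<kappa>_bounds mult_left_le[of x \<kappa>] by (auto simp: mult.commute)

lemma continuous_angle: "continuous_on {0..1} angle"
  unfolding angle_def using angle_arg by (intro continuous_intros) auto

lemma angle_bounds: "x \<in> {0..1} \<Longrightarrow> \<bar>angle x\<bar> \<le> arccos (1 - \<kappa>)"
  using angle_arg[of x] \<kappa>_bounds arccos_lbound[of "1 - \<kappa> * x"]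
  by (auto simp: angle_def intro!: arccos_le_arccos)

text \<open>With \<open>B = arccos C\<close>, the squares of \<open>sin B\<close> and
  \<open>S\<close> agree, so \<open>S = Q sin B\<close> for a symmetry \<open>Q\<close>. Then
  \<open>W = Q J\<close> is skew, squares to \<open>- I\<close> and commutes with \<open>B\<close>;
  so \<open>U t = cos (t B) + W sin (t B)\<close> is the group generated by \<open>w = W B\<close>,
  and \<open>U 1 = C + J S\<close>. The last conclusion, on commutants, is for uniqueness.\<close>

lemma rotation:
  obtains U w where "\<And>t. (U has_vector_derivative w o\<^sub>L U t) (at t)"
    "U 0 = id_blinfun" "U 1 = \<epsilon>\<^sub>1 o\<^sub>L \<epsilon>\<^sub>0"
    "\<And>t. is_adjoint (U t) (U (- t))" "\<And>t. U t o\<^sub>L U (- t) = id_blinfun"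
    "\<And>t. \<epsilon>\<^sub>0 o\<^sub>L U t = U (- t) o\<^sub>L \<epsilon>\<^sub>0" "\<And>t. commuting J (U t)"
    "is_adjoint w (- w)" "norm w \<le> arccos (1 - \<kappa>)"
    "\<And>X t. commuting X J \<Longrightarrow> commuting X (\<epsilon>\<^sub>1 o\<^sub>L \<epsilon>\<^sub>0) \<Longrightarrow> commuting X (\<epsilon>\<^sub>0 o\<^sub>L \<epsilon>\<^sub>1) \<Longrightarrow> commuting X (U t)"
proof -
  have cont: "continuous_on {0..1} (\<lambda>x. cos (t * angle x))" "continuous_on {0..1} (\<lambda>x. sin (t * angle x))" for t
    by (intro continuous_intros continuous_angle)+
  \<comment> \<open>This is \<open>arccos C\<close>, because \<open>C = I - \<kappa> T\<close> and
    \<open>angle\<close> is \<open>arccos\<close> in the variable of \<open>T\<close>.\<close>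
  define B where "B = fcalc angle"
  define Cs where "Cs t = fcalc (\<lambda>x. cos (t * angle x))" for t
  define Sn where "Sn t = fcalc (\<lambda>x. sin (t * angle x))" for t
  have symm: "is_adjoint B B" "is_adjoint (Cs t) (Cs t)" "is_adjoint (Sn t) (Sn t)" for t
    unfolding B_def Cs_def Sn_def by (intro fcalc_symmetric cont continuous_angle)+
  have commT: "commuting X B" "commuting X (Cs t)" "commuting X (Sn t)" if "commuting X T" for X t
    unfolding B_def Cs_def Sn_def by (intro commuting_fcalc cont continuous_angle that)+
  have T_self: "commuting B T" "commuting (Cs t) T" "commuting (Sn t) T" for t
    using commT[of T] by auto
  have CsSn: "commuting (Cs s) (Sn t)" "commuting B (Sn t)" "commuting B (Cs t)" for s t
    by (intro commT T_self)+
  have commC: "commuting X T" if "commuting X C" for X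
    using commutingD[OF that] by (intro commutingI) (simp add: T_def blinfun.bilinear_simps)
  have C1: "Cs 1 = C"
  proof -
    have "Cs 1 = fcalc (\<lambda>x. 1 - \<kappa> * x)"
      unfolding Cs_def using angle_arg by (intro fcalc_cong continuous_intros continuous_angle) (auto simp: angle_def)
    then show ?thesis by (simp add: C_eq fcalc_diff fcalc_const fcalc_scaleR fcalc_ident continuous_intros)
  qed
  have unit: "(Cs t o\<^sub>L Cs t) + (Sn t o\<^sub>L Sn t) = id_blinfun" for t
  proof -
    have "(Cs t o\<^sub>L Cs t) + (Sn t o\<^sub>L Sn t) =
        fcalc (\<lambda>x. cos (t * angle x) * cos (t * angle x) + sin (t * angle x) * sin (t * angle x))"
      unfolding Cs_def Sn_def fcalc_mult[OF cont(1) cont(1), symmetric] fcalc_mult[OF cont(2) cont(2), symmetric]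
      by (rule fcalc_add[symmetric]) (intro continuous_on_mult cont)+
    also have "(\<lambda>x. cos (t * angle x) * cos (t * angle x) + sin (t * angle x) * sin (t * angle x)) = (\<lambda>x. 1)"
      by (simp flip: power2_eq_square)
    finally show ?thesis by (simp add: fcalc_const)
  qed
  have S_symm: "is_adjoint S S"
  proof -
    have "is_adjoint S ((- 1/2) *\<^sub>R (((\<epsilon>\<^sub>0 o\<^sub>L \<epsilon>\<^sub>1) - (\<epsilon>\<^sub>1 o\<^sub>L \<epsilon>\<^sub>0)) o\<^sub>L (- J)))"
      unfolding S_def by (intro is_adjoint_intros endpoint_simps J_adjoint)
    also have "((\<epsilon>\<^sub>0 o\<^sub>L \<epsilon>\<^sub>1) - (\<epsilon>\<^sub>1 o\<^sub>L \<epsilon>\<^sub>0)) o\<^sub>L (- J) = J o\<^sub>L ((\<epsilon>\<^sub>1 o\<^sub>L \<epsilon>\<^sub>0) - (\<epsilon>\<^sub>0 o\<^sub>L \<epsilon>\<^sub>1))"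
      by (rule blinfun_eqI) (simp add: blinfun.bilinear_simps endpoint_simps)
    finally show ?thesis by (simp add: S_def)
  qed
  have "commuting S C"
    by (rule commutingI) (simp add: S_def C_def blinfun.bilinear_simps endpoint_simps algebra_simps)
  then have SnS: "commuting (Sn 1) S" using commT(3)[OF commC] by metis
  have "Sn 1 o\<^sub>L Sn 1 = id_blinfun - (C o\<^sub>L C)"
    using unit[of 1] by (simp add: C1 algebra_simps)
  also have "\<dots> = S o\<^sub>L S"
  proof (rule blinfun_eqI)
    fix x
    have four: "(1/4) *\<^sub>R y + ((1/4) *\<^sub>R y + ((1/4) *\<^sub>R y + (1/4) *\<^sub>R y)) = y" for y :: 'a
      by (simp flip: scaleR_add_left)
    show "(id_blinfun - (C o\<^sub>L C)) x = (S o\<^sub>L S) x"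
      using four[of x]
      by (simp add: S_def C_def blinfun.bilinear_simps endpoint_simps algebra_simps)
  qed
  finally have sq: "Sn 1 o\<^sub>L Sn 1 = S o\<^sub>L S" .
  show thesis
  proof (rule sign_operator[OF symm(3)[of 1] S_symm SnS sq])
    fix Q :: "'a \<Rightarrow>\<^sub>L 'a"
    assume Q: "is_adjoint Q Q" "Q o\<^sub>L Q = id_blinfun" "Q o\<^sub>L Sn 1 = S"
      "\<And>X. commuting X (Sn 1) \<Longrightarrow> commuting X S \<Longrightarrow> commuting X Q"
    have J_C: "commuting J C" and J_S: "commuting J S" and e_C: "commuting \<epsilon>\<^sub>0 C" and e_S: "commuting \<epsilon>\<^sub>0 S"
      by (auto intro!: commutingI simp: S_def C_def blinfun.bilinear_simps endpoint_simps algebra_simps)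
    \<comment> \<open>\<open>C\<close> commutes with \<open>Sn 1\<close> and \<open>S\<close>, hence
      with \<open>Q\<close>; so \<open>Q\<close> commutes with all functions of
      \<open>T\<close>.\<close>
    have QT: "commuting Q T"
    proof -
      have "commuting C S" using \<open>commuting S C\<close> by simp
      moreover have "commuting C (Sn 1)" by (rule commT, rule commC) simp
      ultimately show ?thesis using commC[of Q] Q(4)[of C] by simp
    qed
    have JQ: "commuting J Q" and eQ: "commuting \<epsilon>\<^sub>0 Q"
      by (intro Q(4) commT commC J_C e_C J_S e_S)+
    note Jc = commT[OF commC[OF J_C]] and ec = commT[OF commC[OF e_C]] and Qc = commT[OF QT]
    define W where "W = Q o\<^sub>L J"
    define w where "w = W o\<^sub>L B"
    define U where "U t = Cs t + (W o\<^sub>L Sn t)" for t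
    have WW: "W o\<^sub>L W = - id_blinfun"
      by (rule blinfun_eqI)
        (simp add: W_def blinfun.bilinear_simps commutingD[OF JQ] J_J blinfun_compose_eqD[OF Q(2)])
    have W_adj: "is_adjoint W (- W)"
    proof -
      have "is_adjoint W ((- J) o\<^sub>L Q)" unfolding W_def by (intro is_adjoint_intros Q J_adjoint)
      also have "(- J) o\<^sub>L Q = - W"
        by (rule blinfun_eqI) (simp add: W_def blinfun.bilinear_simps commutingD[OF JQ])
      finally show ?thesis .
    qed
    have We: "\<epsilon>\<^sub>0 (W x) = - W (\<epsilon>\<^sub>0 x)" for x
      by (simp add: W_def commutingD[OF eQ] endpoint_simps blinfun.bilinear_simps)
    have JW: "J (W x) = W (J x)" for x by (simp add: W_def commutingD[OF JQ])
    have Wc: "commuting W B" "commuting W (Cs t)" "commuting W (Sn t)" for t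
      using Jc Qc by (auto intro!: commutingI simp: W_def commutingD[OF Jc(1)] commutingD[OF Jc(2)]
          commutingD[OF Jc(3)] commutingD[OF Qc(1)] commutingD[OF Qc(2)] commutingD[OF Qc(3)])
    have neg: "Cs (- t) = Cs t" "Sn (- t) = - Sn t" for t
      using fcalc_scaleR[OF cont(2), of "-1" t] by (simp_all add: Cs_def Sn_def)
    \<comment> \<open>Commuting with \<open>J\<close> and both products of the end points forces
      commuting with \<open>C\<close> and \<open>S\<close>, from which, with \<open>J\<close>, the
      operators \<open>T\<close>, \<open>Q\<close> and \<open>W\<close> are built.\<close>
    have W_bicommutant: "commuting X W \<and> commuting X T"
      if "commuting X J" "commuting X (\<epsilon>\<^sub>1 o\<^sub>L \<epsilon>\<^sub>0)" "commuting X (\<epsilon>\<^sub>0 o\<^sub>L \<epsilon>\<^sub>1)" for X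
    proof -
      have X: "X (J x) = J (X x)" "X (\<epsilon>\<^sub>1 (\<epsilon>\<^sub>0 x)) = \<epsilon>\<^sub>1 (\<epsilon>\<^sub>0 (X x))" "X (\<epsilon>\<^sub>0 (\<epsilon>\<^sub>1 x)) = \<epsilon>\<^sub>0 (\<epsilon>\<^sub>1 (X x))" for x
        using commutingD[OF that(1), of x] commutingD[OF that(2), of x] commutingD[OF that(3), of x] by simp_all
      have XC: "commuting X C" and XS: "commuting X S"
        by (auto intro!: commutingI simp: C_def S_def blinfun.bilinear_simps X)
      have "commuting X Q" by (intro Q(4) commT commC XC XS)
      then show ?thesis using commC[OF XC] X(1)
        by (auto intro!: commutingI simp: W_def commutingD[of X Q])
    qed
    show thesis
    proof (rule that[of U w])
      fix t
      have "(U has_vector_derivative (- (B o\<^sub>L Sn t)) + (W o\<^sub>L (B o\<^sub>L Cs t))) (at t)"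
        unfolding U_def Cs_def Sn_def B_def
        by (intro has_vector_derivative_add fcalc_cos_sin_derivative continuous_angle
            bounded_linear.has_vector_derivative[OF bounded_bilinear.bounded_linear_right[OF bounded_bilinear_blinfun_compose]])
      also have "(- (B o\<^sub>L Sn t)) + (W o\<^sub>L (B o\<^sub>L Cs t)) = w o\<^sub>L U t"
        by (rule blinfun_eqI)
          (simp add: U_def w_def blinfun.bilinear_simps commutingD[OF Wc(1), symmetric]
            blinfun_compose_eqD[OF WW])
      finally show "(U has_vector_derivative w o\<^sub>L U t) (at t)" .
      show "U 0 = id_blinfun" by (simp add: U_def Cs_def Sn_def fcalc_const)
      show "U 1 = \<epsilon>\<^sub>1 o\<^sub>L \<epsilon>\<^sub>0"
      proof (rule blinfun_eqI)
        fix x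
        have half: "(1/2) *\<^sub>R y + (1/2) *\<^sub>R y = y" for y :: 'a by (simp flip: scaleR_add_left)
        have "W (Sn 1 x) = J (S x)"
          by (simp add: W_def commutingD[OF JQ, symmetric] blinfun_compose_eqD[OF Q(3)])
        also have "\<dots> = (1/2) *\<^sub>R \<epsilon>\<^sub>1 (\<epsilon>\<^sub>0 x) - (1/2) *\<^sub>R \<epsilon>\<^sub>0 (\<epsilon>\<^sub>1 x)"
          by (simp add: S_def blinfun.bilinear_simps J_J algebra_simps)
        finally show "U 1 x = (\<epsilon>\<^sub>1 o\<^sub>L \<epsilon>\<^sub>0) x"
          by (simp add: U_def C1 C_def blinfun.bilinear_simps scaleR_add_right half)
      qed
      have "is_adjoint (U t) (Cs t + (Sn t o\<^sub>L (- W)))"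
        unfolding U_def by (intro is_adjoint_intros symm W_adj)
      also have "Cs t + (Sn t o\<^sub>L (- W)) = U (- t)"
        by (rule blinfun_eqI) (simp add: U_def neg blinfun.bilinear_simps commutingD[OF Wc(3)])
      finally show "is_adjoint (U t) (U (- t))" .
      have unit': "Cs t (Cs t x) + Sn t (Sn t x) = x" for x
        using arg_cong[OF unit[of t], of "\<lambda>X. blinfun_apply X x"] by (simp add: blinfun.bilinear_simps)
      show "U t o\<^sub>L U (- t) = id_blinfun"
        by (rule blinfun_eqI)
          (simp add: U_def neg blinfun.bilinear_simps commutingD[OF Wc(2), symmetric] commutingD[OF Wc(3), symmetric]
            commutingD[OF CsSn(1)] blinfun_compose_eqD[OF WW] unit')
      show "\<epsilon>\<^sub>0 o\<^sub>L U t = U (- t) o\<^sub>L \<epsilon>\<^sub>0"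
        by (rule blinfun_eqI)
          (simp add: U_def neg blinfun.bilinear_simps We commutingD[OF ec(2)] commutingD[OF ec(3)])
      show "commuting J (U t)"
        by (rule commutingI) (simp add: U_def blinfun.bilinear_simps JW commutingD[OF Jc(2)] commutingD[OF Jc(3)])
    next
      have "is_adjoint w (B o\<^sub>L (- W))" unfolding w_def by (intro is_adjoint_intros symm W_adj)
      also have "B o\<^sub>L (- W) = - w"
        by (rule blinfun_eqI) (simp add: w_def blinfun.bilinear_simps commutingD[OF Wc(1)])
      finally show "is_adjoint w (- w)" .
      have "(- W) o\<^sub>L W = id_blinfun"
        by (rule blinfun_eqI) (simp add: blinfun.bilinear_simps blinfun_compose_eqD[OF WW])
      then have "norm W \<le> 1"
        by (intro norm_blinfun_bound) (simp_all add: norm_isometry[OF W_adj])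
      moreover have "norm B \<le> arccos (1 - \<kappa>)"
        unfolding B_def by (intro norm_fcalc_le continuous_angle angle_bounds)
      ultimately show "norm w \<le> arccos (1 - \<kappa>)"
        unfolding w_def using norm_blinfun_compose[of W B] mult_left_le[of "norm W" "norm B"]
        by (simp add: mult.commute)
    next
      fix X :: "'a \<Rightarrow>\<^sub>L 'a" and t
      assume X: "commuting X J" "commuting X (\<epsilon>\<^sub>1 o\<^sub>L \<epsilon>\<^sub>0)" "commuting X (\<epsilon>\<^sub>0 o\<^sub>L \<epsilon>\<^sub>1)"
      note XW = W_bicommutant[OF X, THEN conjunct1] and XT = W_bicommutant[OF X, THEN conjunct2]
      show "commuting X (U t)"
        by (rule commutingI) (simp add: U_def blinfun.bilinear_simps commutingD[OF XW]
            commutingD[OF commT(2)[OF XT]] commutingD[OF commT(3)[OF XT]])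
    qed
  qed
qed

section \<open>A lower bound for the length of joining curves\<close>

lemma curve_length_ge:
  assumes ab: "a < b" and \<gamma>: "piecewise_C1_on a b \<gamma>" "\<And>t. t \<in> {a..b} \<Longrightarrow> \<gamma> t \<in> lagrangian_grassmannian J"
    and ends: "joins a b \<gamma> \<epsilon>\<^sub>0 \<epsilon>\<^sub>1"
  shows "arccos (1 - \<kappa>) \<le> curve_length a b \<gamma>"
proof (rule ccontr)
  \<comment> \<open>A shorter curve would give both \<open>cos L > 1 - \<kappa>\<close> and
    \<open>\<kappa> \<le> 1 - cos L\<close>. The contradiction hypothesis keeps \<open>L\<close>
    below pi, where cosine is monotone, and avoids asking for a vector that attains the
    norm.\<close>
  define L where "L = curve_length a b \<gamma>"
  assume "\<not> arccos (1 - \<kappa>) \<le> curve_length a b \<gamma>"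
  then have L: "L < arccos (1 - \<kappa>)" by (simp add: L_def)
  \<comment> \<open>A non-integrable speed has integral 0 by convention, so the sign is right in
    either case.\<close>
  have "0 \<le> L" unfolding L_def curve_length_def
    by (cases "(\<lambda>t. norm (velocity a b \<gamma> t)) integrable_on {a..b}")
      (auto intro: integral_nonneg simp: not_integrable_integral)
  have pi: "arccos (1 - \<kappa>) \<le> pi" using \<kappa>_bounds by (intro arccos_ubound) auto
  have "cos (arccos (1 - \<kappa>)) < cos L"
    using \<open>0 \<le> L\<close> L pi by (rule cos_monotone_0_pi)
  then have cosL: "1 - \<kappa> < cos L" using \<kappa>_bounds by simp
  \<comment> \<open>For a unit vector \<open>x\<close> this is the cosine of the angle between the
    ends of the curve \<open>\<gamma> x\<close>.\<close>
  have inner_C: "inner (\<epsilon>\<^sub>0 x) (\<epsilon>\<^sub>1 x) = inner (C x) x" for x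
    using is_adjointD[OF lagrangian_simps(1)[OF \<epsilon>\<^sub>1], of "\<epsilon>\<^sub>0 x" x] is_adjointD[OF lagrangian_simps(1)[OF \<epsilon>\<^sub>0], of "\<epsilon>\<^sub>1 x" x]
    by (simp add: C_def blinfun.bilinear_simps inner_simps inner_commute)
  have unit: "cos L \<le> inner (C x) x" if "norm x = 1" for x
  proof -
    have "arccos (inner (\<gamma> a x) (\<gamma> b x)) \<le> L"
      unfolding L_def using that by (intro angle_le_curve_length ab \<gamma>) (simp_all add: lagrangian_simps(4)[OF \<gamma>(2)])
    then have "arccos (inner (C x) x) \<le> L"
      using ends by (simp add: joins_def inner_C)
    moreover have "\<bar>inner (C x) x\<bar> \<le> 1"
      using Cauchy_Schwarz_ineq2[of "\<epsilon>\<^sub>0 x" "\<epsilon>\<^sub>1 x"] that by (simp add: inner_C endpoint_simps)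
    ultimately show ?thesis
      using cos_monotone_0_pi_le[of "arccos (inner (C x) x)" L] L pi by (simp add: arccos_lbound abs_le_iff)
  qed
  have "\<kappa> \<le> 1 - cos L"
    unfolding \<kappa>_def
  proof (rule symmetric_norm_le)
    show "is_adjoint (id_blinfun - C) (id_blinfun - C)" by (intro is_adjoint_intros C_symmetric)
    fix x
    have "inner (x - C x) x \<le> (1 - cos L) * (norm x)\<^sup>2"
    proof (cases "x = 0")
      case False
      define y where "y = (1 / norm x) *\<^sub>R x"
      have x: "x = norm x *\<^sub>R y" and "norm y = 1" using False by (simp_all add: y_def)
      have "inner (x - C x) x = (norm x)\<^sup>2 * (inner y y - inner (C y) y)"
        by (subst (1 2 3) x) (simp add: blinfun.bilinear_simps inner_simps power2_eq_square algebra_simps)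
      also have "\<dots> \<le> (norm x)\<^sup>2 * (1 - cos L)"
        using unit[OF \<open>norm y = 1\<close>] \<open>norm y = 1\<close> by (intro mult_left_mono) (auto simp: norm_eq_sqrt_inner)
      finally show ?thesis by (simp add: mult.commute)
    qed simp
    moreover have "0 \<le> inner (x - C x) x" by (simp add: defect_inner)
    ultimately show "\<bar>inner ((id_blinfun - C) x) x\<bar> \<le> (1 - cos L) * (norm x)\<^sup>2"
      by (simp add: blinfun.bilinear_simps)
  qed simp
  then show False using cosL by simp
qed

section \<open>Geodesics as flows with a constant generator\<close>

lemma norm_lagrangian_le: "\<epsilon> \<in> lagrangian_grassmannian J \<Longrightarrow> norm \<epsilon> \<le> 1"
  by (rule norm_blinfun_bound) (simp_all add: lagrangian_simps)

text \<open>Right multiplication by the involution \<open>\<delta> t\<close>, of norm at most 1,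
  preserves the operator norm, so the speed is constantly \<open>norm w\<close>.\<close>

lemma curve_length_flow:
  assumes \<delta>: "\<And>t. t \<in> {0..1} \<Longrightarrow> \<delta> t \<in> lagrangian_grassmannian J"
    and flow: "\<And>t. t \<in> {0..1} \<Longrightarrow> (\<delta> has_vector_derivative w o\<^sub>L \<delta> t) (at t within {0..1})"
  shows "curve_length 0 1 \<delta> = norm w"
proof -
  have "norm (velocity 0 1 \<delta> t) = norm w" if t: "t \<in> {0..1}" for t
  proof -
    note n = norm_lagrangian_le[OF \<delta>[OF t]]
    have v: "velocity 0 1 \<delta> t = w o\<^sub>L \<delta> t" using velocity_eqI[OF flow[OF t]] t by simp
    have "norm (w o\<^sub>L \<delta> t) \<le> norm w * norm (\<delta> t)" by (rule norm_blinfun_compose)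
    also have "\<dots> \<le> norm w" using n by (simp add: mult_left_le)
    finally have le: "norm (w o\<^sub>L \<delta> t) \<le> norm w" .
    have "w = (w o\<^sub>L \<delta> t) o\<^sub>L \<delta> t"
      by (rule blinfun_eqI) (simp add: lagrangian_simps[OF \<delta>[OF t]])
    then have "norm w \<le> norm (w o\<^sub>L \<delta> t) * norm (\<delta> t)" using norm_blinfun_compose by metis
    also have "\<dots> \<le> norm (w o\<^sub>L \<delta> t)" using n by (simp add: mult_left_le)
    finally show ?thesis using le v by simp
  qed
  then have "curve_length 0 1 \<delta> = integral {0..1} (\<lambda>t::real. norm w)"
    unfolding curve_length_def by (intro integral_cong) simp
  then show ?thesis by simp
qed

lemma geodesic_flow:
  assumes geo: "geodesic J 0 1 \<delta>"
  obtains w where "\<And>t. t \<in> {0..1} \<Longrightarrow> (\<delta> has_vector_derivative w o\<^sub>L \<delta> t) (at t within {0..1})"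
    "is_adjoint w (- w)" "commuting w J" "\<And>t. t \<in> {0..1} \<Longrightarrow> w o\<^sub>L \<delta> t = - (\<delta> t o\<^sub>L w)"
proof -
  define v where "v = velocity 0 1 \<delta>"
  define A where "A = velocity 0 1 v"
  have \<delta>: "\<delta> t \<in> lagrangian_grassmannian J" if "t \<in> {0..1}" for t
    using geo that by (simp add: geodesic_def)
  have dd: "(\<delta> has_vector_derivative v t) (at t within {0..1})"
    and dv: "(v has_vector_derivative A t) (at t within {0..1})" if "t \<in> {0..1}" for t
    using geo that unfolding geodesic_def v_def A_def by (blast intro: velocity_works)+
  have parallel: "A t = \<delta> t o\<^sub>L A t o\<^sub>L \<delta> t" if "t \<in> {0..1}" for t
    using geo that unfolding geodesic_def covariant_derivative_def tangent_proj_def v_def A_def by simp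
  have sq: "\<delta> t o\<^sub>L \<delta> t = id_blinfun" if "t \<in> {0..1}" for t
    using \<delta>[OF that] by (simp add: lagrangian_grassmannian_def)
  have anti: "(\<delta> t o\<^sub>L v t) + (v t o\<^sub>L \<delta> t) = 0" if "t \<in> {0..1}" for t
    using vector_derivative_unique_Icc[OF has_vector_derivative_compose[OF dd[OF that] dd[OF that]]
        has_vector_derivative_const sq that] by simp
  have anti': "\<delta> t (v t x) = - v t (\<delta> t x)" if "t \<in> {0..1}" for t x
    using arg_cong[OF anti[OF that], of "\<lambda>X. blinfun_apply X x"]
    by (simp add: blinfun.bilinear_simps eq_neg_iff_add_eq_0)
  have second: "((\<delta> t o\<^sub>L A t) + (v t o\<^sub>L v t)) + ((v t o\<^sub>L v t) + (A t o\<^sub>L \<delta> t)) = 0" if "t \<in> {0..1}" for t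
    using vector_derivative_unique_Icc[OF has_vector_derivative_add[OF
        has_vector_derivative_compose[OF dd[OF that] dv[OF that]] has_vector_derivative_compose[OF dv[OF that] dd[OF that]]]
        has_vector_derivative_const anti that] by simp
  have "(v t o\<^sub>L v t) + (A t o\<^sub>L \<delta> t) = 0" if t: "t \<in> {0..1}" for t
  proof (rule blinfun_eqI)
    fix x
    have "A t (\<delta> t x) = \<delta> t (A t x)"
      using arg_cong[OF parallel[OF t], of "\<lambda>X. blinfun_apply X (\<delta> t x)"] by (simp add: lagrangian_simps[OF \<delta>[OF t]])
    then have "2 *\<^sub>R (v t (v t x) + A t (\<delta> t x)) = 0"
      using arg_cong[OF second[OF t], of "\<lambda>X. blinfun_apply X x"]
      by (simp add: blinfun.bilinear_simps scaleR_2 algebra_simps)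
    then show "((v t o\<^sub>L v t) + (A t o\<^sub>L \<delta> t)) x = blinfun_apply 0 x"
      by (simp add: blinfun.bilinear_simps)
  qed
  then have "((\<lambda>t. v t o\<^sub>L \<delta> t) has_vector_derivative 0) (at t within {0..1})" if "t \<in> {0..1}" for t
    using has_vector_derivative_compose[OF dv[OF that] dd[OF that]] that by simp
  then obtain w where w: "\<And>t. t \<in> {0..1} \<Longrightarrow> v t o\<^sub>L \<delta> t = w"
    using has_vector_derivative_zero_constant[of "{0..1}" "\<lambda>t. v t o\<^sub>L \<delta> t"] by (metis convex_real_interval(5))
  have w_apply: "w x = v t (\<delta> t x)" if "t \<in> {0..1}" for t x
    using blinfun_compose_eqD[OF w[OF that]] by simp
  \<comment> \<open>Symmetry and anticommutation with \<open>J\<close> are linear in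
    \<open>\<delta>\<close>, so the velocity at 0 inherits both. As \<open>v 0\<close> also
    anticommutes with \<open>\<delta> 0\<close>, their product \<open>w\<close> is skew and commutes
    with \<open>J\<close>.\<close>
  have v_symm: "inner (v 0 x) y = inner x (v 0 y)" for x y
  proof (rule vector_derivative_unique_Icc[where t = 0 and a = 0 and b = 1])
    have "((\<lambda>t. \<delta> t z) has_vector_derivative v 0 z) (at 0 within {0..1})" for z
      using bounded_linear.has_vector_derivative[OF blinfun.bounded_linear_left dd, of 0] by simp
    then show "((\<lambda>t. inner (\<delta> t x) y) has_vector_derivative inner (v 0 x) y) (at 0 within {0..1})"
      "((\<lambda>t. inner x (\<delta> t y)) has_vector_derivative inner x (v 0 y)) (at 0 within {0..1})"
      using bounded_linear.has_vector_derivative[OF bounded_linear_inner_left]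
        bounded_linear.has_vector_derivative[OF bounded_linear_inner_right] by blast+
    show "inner (\<delta> t x) y = inner x (\<delta> t y)" if "t \<in> {0..1}" for t
      using lagrangian_simps(1)[OF \<delta>[OF that]] by (rule is_adjointD)
  qed auto
  have v_J: "v 0 o\<^sub>L J = - (J o\<^sub>L v 0)"
  proof (rule vector_derivative_unique_Icc[where t = 0 and a = 0 and b = 1])
    show "((\<lambda>t. \<delta> t o\<^sub>L J) has_vector_derivative v 0 o\<^sub>L J) (at 0 within {0..1})"
      using has_vector_derivative_compose[OF dd has_vector_derivative_const, of 0 J] by simp
    show "((\<lambda>t. - (J o\<^sub>L \<delta> t)) has_vector_derivative - (J o\<^sub>L v 0)) (at 0 within {0..1})"
      using has_vector_derivative_minus[OF has_vector_derivative_compose[OF has_vector_derivative_const dd, of 0 J]]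
      by simp
    show "\<delta> t o\<^sub>L J = - (J o\<^sub>L \<delta> t)" if "t \<in> {0..1}" for t
      using \<delta>[OF that] by (simp add: lagrangian_grassmannian_def)
  qed auto
  have v_J': "v 0 (J x) = - J (v 0 x)" for x
    using blinfun_compose_eqD[OF v_J] by (simp add: blinfun.bilinear_simps)
  have 0: "(0::real) \<in> {0..1}" by simp
  note \<delta>0 = lagrangian_simps[OF \<delta>[OF 0]]
  show thesis
  proof (rule that[of w])
    show "(\<delta> has_vector_derivative w o\<^sub>L \<delta> t) (at t within {0..1})" if "t \<in> {0..1}" for t
    proof -
      have "w o\<^sub>L \<delta> t = v t"
        by (rule blinfun_eqI) (simp add: w_apply[OF that] lagrangian_simps[OF \<delta>[OF that]])
      then show ?thesis using dd[OF that] by simp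
    qed
    show "is_adjoint w (- w)"
      using \<delta>0(1) by (simp add: is_adjoint_def w_apply[OF 0] v_symm blinfun.bilinear_simps flip: anti'[OF 0])
    show "commuting w J"
      by (rule commutingI) (simp add: w_apply[OF 0] \<delta>0 v_J' blinfun.bilinear_simps)
    show "w o\<^sub>L \<delta> t = - (\<delta> t o\<^sub>L w)" if "t \<in> {0..1}" for t
      by (rule blinfun_eqI)
        (simp add: w_apply[OF that] anti'[OF that] lagrangian_simps[OF \<delta>[OF that]] blinfun.bilinear_simps)
  qed
qed

section \<open>Existence and uniqueness of minimal geodesics\<close>

lemma minimal_geodesics:
  "(\<exists>\<delta>. minimal_geodesic J \<epsilon>\<^sub>0 \<epsilon>\<^sub>1 \<delta>) \<and>
    (norm (\<epsilon>\<^sub>0 - \<epsilon>\<^sub>1) < 2 \<longrightarrow>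
      (\<forall>\<delta> \<delta>'. minimal_geodesic J \<epsilon>\<^sub>0 \<epsilon>\<^sub>1 \<delta> \<and> minimal_geodesic J \<epsilon>\<^sub>0 \<epsilon>\<^sub>1 \<delta>' \<longrightarrow>
        (\<forall>t\<in>{0..1}. \<delta> t = \<delta>' t)))"
proof (rule rotation)
  fix U w
  assume dU: "\<And>t. (U has_vector_derivative w o\<^sub>L U t) (at t)"
    and U0: "U 0 = id_blinfun" and U1: "U 1 = \<epsilon>\<^sub>1 o\<^sub>L \<epsilon>\<^sub>0"
    and U_adj: "\<And>t. is_adjoint (U t) (U (- t))" and U_inv: "\<And>t. U t o\<^sub>L U (- t) = id_blinfun"
    and eU: "\<And>t. \<epsilon>\<^sub>0 o\<^sub>L U t = U (- t) o\<^sub>L \<epsilon>\<^sub>0" and JU: "\<And>t. commuting J (U t)"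
    and w_adj: "is_adjoint w (- w)" and norm_w: "norm w \<le> arccos (1 - \<kappa>)"
    and U_comm: "\<And>X t. commuting X J \<Longrightarrow> commuting X (\<epsilon>\<^sub>1 o\<^sub>L \<epsilon>\<^sub>0) \<Longrightarrow> commuting X (\<epsilon>\<^sub>0 o\<^sub>L \<epsilon>\<^sub>1) \<Longrightarrow> commuting X (U t)"
  define \<delta>\<^sub>0 where "\<delta>\<^sub>0 t = U t o\<^sub>L \<epsilon>\<^sub>0" for t
  have eU': "\<epsilon>\<^sub>0 (U t x) = U (- t) (\<epsilon>\<^sub>0 x)" for t x using blinfun_compose_eqD[OF eU[of t]] by simp
  have U_inv': "U t (U (- t) x) = x" "U (- t) (U t x) = x" for t x
    using blinfun_compose_eqD[OF U_inv[of t]] blinfun_compose_eqD[OF U_inv[of "- t"]] by simp_all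
  have lag: "\<delta>\<^sub>0 t \<in> lagrangian_grassmannian J" for t
  proof -
    have "is_adjoint (\<delta>\<^sub>0 t) (\<epsilon>\<^sub>0 o\<^sub>L U (- t))" unfolding \<delta>\<^sub>0_def by (intro is_adjoint_intros U_adj endpoint_simps)
    also have "\<epsilon>\<^sub>0 o\<^sub>L U (- t) = \<delta>\<^sub>0 t" by (simp add: \<delta>\<^sub>0_def eU)
    finally show ?thesis
      by (auto intro!: blinfun_eqI simp: lagrangian_grassmannian_def \<delta>\<^sub>0_def eU' U_inv' endpoint_simps
          blinfun.bilinear_simps commutingD[OF JU])
  qed
  have d\<delta>: "(\<delta>\<^sub>0 has_vector_derivative w o\<^sub>L \<delta>\<^sub>0 t) (at t within s)" for t s
    using has_vector_derivative_at_within[OF has_vector_derivative_compose[OF dU[of t] has_vector_derivative_const[where c = \<epsilon>\<^sub>0]], of s]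
    by (simp add: \<delta>\<^sub>0_def[abs_def] blinfun_compose_assoc)
  have vel: "velocity 0 1 \<delta>\<^sub>0 t = w o\<^sub>L \<delta>\<^sub>0 t" if "t \<in> {0..1}" for t
    using velocity_eqI[OF d\<delta>] that by simp
  have dvel: "(velocity 0 1 \<delta>\<^sub>0 has_vector_derivative w o\<^sub>L (w o\<^sub>L \<delta>\<^sub>0 t)) (at t within {0..1})" if "t \<in> {0..1}" for t
  proof (rule has_vector_derivative_transform[OF that vel])
    show "((\<lambda>t. w o\<^sub>L \<delta>\<^sub>0 t) has_vector_derivative w o\<^sub>L (w o\<^sub>L \<delta>\<^sub>0 t)) (at t within {0..1})"
      using has_vector_derivative_compose[OF has_vector_derivative_const[where c = w] d\<delta>[of t "{0..1}"]] by simp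
  qed
  have sq: "\<delta>\<^sub>0 t o\<^sub>L \<delta>\<^sub>0 t = id_blinfun" for t using lag[of t] by (simp add: lagrangian_grassmannian_def)
  have \<delta>w: "\<delta>\<^sub>0 t (w x) = - w (\<delta>\<^sub>0 t x)" if "t \<in> {0..1}" for t x
  proof -
    have "(\<delta>\<^sub>0 t o\<^sub>L (w o\<^sub>L \<delta>\<^sub>0 t)) + ((w o\<^sub>L \<delta>\<^sub>0 t) o\<^sub>L \<delta>\<^sub>0 t) = 0"
      using vector_derivative_unique_Icc[OF has_vector_derivative_compose[OF d\<delta> d\<delta>] has_vector_derivative_const sq that]
      by simp
    from arg_cong[OF this, of "\<lambda>X. blinfun_apply X (\<delta>\<^sub>0 t x)"] show ?thesis
      by (simp add: blinfun.bilinear_simps lagrangian_simps[OF lag] eq_neg_iff_add_eq_0)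
  qed
  have geo: "geodesic J 0 1 \<delta>\<^sub>0"
    unfolding geodesic_def
  proof (intro conjI ballI lag)
    show "\<delta>\<^sub>0 differentiable_on {0..1}" "velocity 0 1 \<delta>\<^sub>0 differentiable_on {0..1}"
      unfolding differentiable_on_def using d\<delta> dvel differentiableI_vector by blast+
    fix t :: real assume t: "t \<in> {0..1}"
    \<comment> \<open>The acceleration contains \<open>w\<close> twice, so the signs from
      anticommutation cancel: it commutes with \<open>\<delta>\<^sub>0 t\<close> and its tangential
      projection vanishes.\<close>
    have "velocity 0 1 (velocity 0 1 \<delta>\<^sub>0) t = w o\<^sub>L (w o\<^sub>L \<delta>\<^sub>0 t)"
      using velocity_eqI[OF dvel[OF t]] t by simp
    then show "covariant_derivative 0 1 \<delta>\<^sub>0 (velocity 0 1 \<delta>\<^sub>0) t = 0"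
      by (auto intro!: blinfun_eqI simp: covariant_derivative_def tangent_proj_def blinfun.bilinear_simps
          \<delta>w[OF t] lagrangian_simps[OF lag])
  qed
  have joins: "joins 0 1 \<delta>\<^sub>0 \<epsilon>\<^sub>0 \<epsilon>\<^sub>1"
    by (auto intro!: blinfun_eqI simp: joins_def \<delta>\<^sub>0_def U0 U1 endpoint_simps)
  have length: "curve_length 0 1 \<delta>\<^sub>0 = norm w"
    by (rule curve_length_flow[OF lag d\<delta>])
  have minimal: "minimal_geodesic J \<epsilon>\<^sub>0 \<epsilon>\<^sub>1 \<delta>\<^sub>0"
    unfolding minimal_geodesic_def
  proof (intro conjI allI impI geo joins)
    fix a b \<gamma>
    assume "a < b \<and> piecewise_C1_on a b \<gamma> \<and> (\<forall>t\<in>{a..b}. \<gamma> t \<in> lagrangian_grassmannian J) \<and> joins a b \<gamma> \<epsilon>\<^sub>0 \<epsilon>\<^sub>1"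
    then have "arccos (1 - \<kappa>) \<le> curve_length a b \<gamma>" by (intro curve_length_ge) auto
    then show "curve_length 0 1 \<delta>\<^sub>0 \<le> curve_length a b \<gamma>" using length norm_w by linarith
  qed
  \<comment> \<open>Admits \<open>\<delta>\<^sub>0\<close> as a competitor of any other minimal
    geodesic, which bounds the generator of that geodesic.\<close>
  have C1: "piecewise_C1_on 0 1 \<delta>\<^sub>0"
  proof -
    have "C1_on 0 1 \<delta>\<^sub>0"
      using geo unfolding C1_on_def geodesic_def by (blast intro: differentiable_imp_continuous_on)
    then show ?thesis unfolding piecewise_C1_on_def by (intro exI[of _ 1] exI[of _ real]) simp
  qed
  have unique: "\<delta> t = \<delta>\<^sub>0 t" if close: "norm (\<epsilon>\<^sub>0 - \<epsilon>\<^sub>1) < 2" and \<delta>: "minimal_geodesic J \<epsilon>\<^sub>0 \<epsilon>\<^sub>1 \<delta>"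
    and t: "t \<in> {0..1}" for \<delta> t
  proof (rule geodesic_flow)
    show \<delta>_geo: "geodesic J 0 1 \<delta>" using \<delta> by (simp add: minimal_geodesic_def)
    fix w'
    assume flow: "\<And>t. t \<in> {0..1} \<Longrightarrow> (\<delta> has_vector_derivative w' o\<^sub>L \<delta> t) (at t within {0..1})"
      and w'_adj: "is_adjoint w' (- w')" and w'J: "commuting w' J"
      and w'\<delta>: "\<And>t. t \<in> {0..1} \<Longrightarrow> w' o\<^sub>L \<delta> t = - (\<delta> t o\<^sub>L w')"
    have ends: "\<delta> 0 = \<epsilon>\<^sub>0" "\<delta> 1 = \<epsilon>\<^sub>1" using \<delta> by (auto simp: minimal_geodesic_def joins_def)
    have "norm w' \<le> arccos (1 - \<kappa>)"
    proof -
      have "curve_length 0 1 \<delta> = norm w'"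
        using \<delta>_geo flow by (intro curve_length_flow) (auto simp: geodesic_def)
      moreover have "curve_length 0 1 \<delta> \<le> curve_length 0 1 \<delta>\<^sub>0"
        using \<delta> lag joins C1 unfolding minimal_geodesic_def by simp
      ultimately show ?thesis using length norm_w by linarith
    qed
    moreover have "arccos (1 - \<kappa>) < pi"
    proof -
      have "(norm (\<epsilon>\<^sub>0 - \<epsilon>\<^sub>1))\<^sup>2 < 2\<^sup>2" using close by (intro power_strict_mono) auto
      then have "\<kappa> < 2" using \<kappa>_le by simp
      then show ?thesis using arccos_less_arccos[of "-1" "1 - \<kappa>"] \<kappa>_bounds by simp
    qed
    ultimately have small: "norm (w' - w) < 2 * pi"
      using norm_triangle_ineq4[of w' w] norm_w by linarith
    have w'_ends: "w' (\<epsilon>\<^sub>0 x) = - \<epsilon>\<^sub>0 (w' x)" "w' (\<epsilon>\<^sub>1 x) = - \<epsilon>\<^sub>1 (w' x)" for x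
      using blinfun_compose_eqD[OF w'\<delta>[of 0], of x] blinfun_compose_eqD[OF w'\<delta>[of 1], of x]
      by (simp_all add: ends blinfun.bilinear_simps)
    \<comment> \<open>Anticommuting with each end point means commuting with their products.\<close>
    have w'_e: "commuting w' (\<epsilon>\<^sub>1 o\<^sub>L \<epsilon>\<^sub>0)" "commuting w' (\<epsilon>\<^sub>0 o\<^sub>L \<epsilon>\<^sub>1)"
      by (auto intro!: commutingI simp: w'_ends blinfun.bilinear_simps)
    have w'U: "commuting w' (U t)" for t by (rule U_comm[OF w'J w'_e])
    \<comment> \<open>The geodesic \<open>\<delta>\<close> seen in the frame that rotates with
      \<open>U\<close>. Because \<open>w'\<close> commutes with \<open>U\<close>, it follows the
      flow of \<open>w' - w\<close>, and it is the identity at both ends.\<close>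
    define V where "V t = U (- t) o\<^sub>L (\<delta> t o\<^sub>L \<epsilon>\<^sub>0)" for t
    have dV: "(V has_vector_derivative (w' - w) o\<^sub>L V t) (at t within {0..1})" if t: "t \<in> {0..1}" for t
    proof -
      have "((\<lambda>t. - t) has_vector_derivative - 1) (at t within {0..1})"
        by (auto intro!: derivative_eq_intros)
      from vector_diff_chain_within[OF this has_vector_derivative_at_within[OF dU]]
      have "((\<lambda>t. U (- t)) has_vector_derivative - (w o\<^sub>L U (- t))) (at t within {0..1})"
        by (simp add: o_def)
      from has_vector_derivative_compose[OF this has_vector_derivative_compose[OF flow[OF t] has_vector_derivative_const]]
      have "(V has_vector_derivative (U (- t) o\<^sub>L ((\<delta> t o\<^sub>L 0) + ((w' o\<^sub>L \<delta> t) o\<^sub>L \<epsilon>\<^sub>0))) +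
          ((- (w o\<^sub>L U (- t))) o\<^sub>L (\<delta> t o\<^sub>L \<epsilon>\<^sub>0))) (at t within {0..1})"
        unfolding V_def .
      also have "(U (- t) o\<^sub>L ((\<delta> t o\<^sub>L 0) + ((w' o\<^sub>L \<delta> t) o\<^sub>L \<epsilon>\<^sub>0))) +
          ((- (w o\<^sub>L U (- t))) o\<^sub>L (\<delta> t o\<^sub>L \<epsilon>\<^sub>0)) = (w' - w) o\<^sub>L V t"
        by (rule blinfun_eqI) (simp add: V_def blinfun.bilinear_simps commutingD[OF w'U])
      finally show ?thesis .
    qed
    have V0: "V 0 = id_blinfun"
      by (rule blinfun_eqI) (simp add: V_def U0 ends endpoint_simps)
    have V1: "V 1 = id_blinfun"
      using U_inv'(2)[of 1] by (intro blinfun_eqI) (simp add: V_def U1 ends endpoint_simps)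
    \<comment> \<open>Every \<open>V t x\<close> is a closed orbit of that flow starting at
      \<open>x\<close>; \<open>norm (w' - w) < 2 * pi\<close> forces the generator to vanish at
      \<open>x\<close>.\<close>
    have "w' - w = 0"
    proof (rule blinfun_eqI)
      fix x
      have "(w' - w) (V 0 x) = 0"
      proof (rule periodic_flow_trivial[OF _ _ _ small])
        show "((\<lambda>t. V t x) has_vector_derivative (w' - w) (V t x)) (at t within {0..1})" if "t \<in> {0..1}" for t
          using bounded_linear.has_vector_derivative[OF blinfun.bounded_linear_left dV[OF that], of x] by simp
        show "is_adjoint (w' - w) (- (w' - w))"
          using is_adjoint_diff[OF w'_adj w_adj] by simp
      qed (simp add: V0 V1)
      then show "(w' - w) x = blinfun_apply 0 x" by (simp add: V0)
    qed
    then have "(V has_vector_derivative 0) (at t within {0..1})" if "t \<in> {0..1}" for t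
      using dV[OF that] by simp
    then obtain c where "\<And>t. t \<in> {0..1} \<Longrightarrow> V t = c"
      using has_vector_derivative_zero_constant[of "{0..1}" V] by (metis convex_real_interval(5))
    then have "V t = V 0" using t by simp
    then have "V t = id_blinfun" by (simp add: V0)
    then have Vt: "U (- t) (\<delta> t (\<epsilon>\<^sub>0 x)) = x" for x
      by (metis V_def blinfun_apply_blinfun_compose blinfun_apply_id_blinfun)
    show "\<delta> t = \<delta>\<^sub>0 t"
    proof (rule blinfun_eqI)
      fix x
      show "\<delta> t x = \<delta>\<^sub>0 t x"
        using arg_cong[OF Vt[of "\<epsilon>\<^sub>0 x"], of "U t"] by (simp add: \<delta>\<^sub>0_def U_inv' endpoint_simps)
    qed
  qed
  show ?thesis
    using minimal unique by (metis (no_types))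
qed

end

theorem theorem3p3:
  fixes J \<epsilon>\<^sub>0 \<epsilon>\<^sub>1 :: "'a::{real_inner,banach} \<Rightarrow>\<^sub>L 'a"
  assumes "complex_structure J"
    and "\<epsilon>\<^sub>0 \<in> lagrangian_grassmannian J"
    and "\<epsilon>\<^sub>1 \<in> lagrangian_grassmannian J"
  shows "(\<exists>\<delta>. minimal_geodesic J \<epsilon>\<^sub>0 \<epsilon>\<^sub>1 \<delta>) \<and>
    (norm (\<epsilon>\<^sub>0 - \<epsilon>\<^sub>1) < 2 \<longrightarrow>
      (\<forall>\<delta> \<delta>'. minimal_geodesic J \<epsilon>\<^sub>0 \<epsilon>\<^sub>1 \<delta> \<and> minimal_geodesic J \<epsilon>\<^sub>0 \<epsilon>\<^sub>1 \<delta>' \<longrightarrow>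
        (\<forall>t\<in>{0..1}. \<delta> t = \<delta>' t)))"
  by (rule lagrangian_pair.minimal_geodesics) (unfold_locales, fact assms(1), fact assms(2), fact assms(3))

end
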